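(* Let $G$ be a connected chordal (finite simple) graph. Then $\Delta L(G)$ is homotopy equivalent to a wedge of $2$-dimensional spheres.
   Context: A graph is chordal if it has no induced cycle of length greater than $3$. The clique complex $\Delta(H)$ of a graph $H$ is the simplicial complex whose simplices are the vertex subsets inducing complete subgraphs. The line graph $L(G)$ has vertex set $E(G)$, two edges being adjacent iff they share exactly one endpoint; $\Delta L(G) = \Delta(L(G))$. A wedge of zero spheres is a point.
   Formalization: The formal theorem additionally assumes that G has at least one edge; this excludes only the one-vertex graph, whose line graph is empty, so that its clique complex is the empty space and not homotopy equivalent to a wedge of spheres (the empty wedge being a point). *)

theory Defs
  imports "HOL-Analysis.Analysis"
begin

section \<open>Graphs\<close>

definition simple_graph :: "'a set \<Rightarrow> 'a set set \<Rightarrow> bool" where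
  "simple_graph V E \<longleftrightarrow> finite V \<and> (\<forall>e\<in>E. e \<subseteq> V \<and> card e = 2)"

definition connected_graph :: "'a set \<Rightarrow> 'a set set \<Rightarrow> bool" where
  "connected_graph V E \<longleftrightarrow>
     V \<noteq> {} \<and> (\<forall>u\<in>V. \<forall>v\<in>V. (\<lambda>x y. {x, y} \<in> E)\<^sup>*\<^sup>* u v)"

definition induced_cycle :: "'a set \<Rightarrow> 'a set set \<Rightarrow> 'a list \<Rightarrow> bool" where
  "induced_cycle V E c \<longleftrightarrow>
     3 \<le> length c \<and> distinct c \<and> set c \<subseteq> V \<and>
     (\<forall>i<length c. \<forall>j<length c.
        {c ! i, c ! j} \<in> E \<longleftrightarrow> j = Suc i mod length c \<or> i = Suc j mod length c)"

definition chordal :: "'a set \<Rightarrow> 'a set set \<Rightarrow> bool" where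
  "chordal V E \<longleftrightarrow> \<not> (\<exists>c. induced_cycle V E c \<and> length c > 3)"

definition line_graph_edges :: "'a set set \<Rightarrow> 'a set set set" where
  "line_graph_edges E = {{e, f} |e f. e \<in> E \<and> f \<in> E \<and> card (e \<inter> f) = 1}"


section \<open>Simplicial complexes\<close>

definition clique_complex :: "'a set \<Rightarrow> 'a set set \<Rightarrow> 'a set set" where
  "clique_complex V E =
     {S. finite S \<and> S \<subseteq> V \<and> (\<forall>x\<in>S. \<forall>y\<in>S. x \<noteq> y \<longrightarrow> {x, y} \<in> E)}"

definition line_clique_complex :: "'a set set \<Rightarrow> 'a set set set" where
  "line_clique_complex E = clique_complex E (line_graph_edges E)"

text \<open>Points are given by their barycentric coordinates. The subspace topology from the
  product is the usual one when the complex is finite; for infinite complexes it may be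
  coarser than the weak topology. The empty simplex contributes no point.\<close>

definition geometric_realization :: "'a set set \<Rightarrow> ('a \<Rightarrow> real) topology" where
  "geometric_realization K =
     subtopology (powertop_real (\<Union>K))
       {x. (\<forall>v\<in>\<Union>K. 0 \<le> x v) \<and> {v \<in> \<Union>K. x v \<noteq> 0} \<in> K \<and> (\<Sum>v\<in>\<Union>K. x v) = 1}"


section \<open>Wedge sums\<close>

text \<open>The wedge of the pointed spaces \<open>(X i, p i)\<close> is the quotient of their disjoint union
  in which all base points are identified to the single point \<open>None\<close>. This point is
  present even if the family is empty, so that the empty wedge is a point.\<close>

definition wedge_map :: "('i \<Rightarrow> 'b) \<Rightarrow> 'i \<times> 'b \<Rightarrow> ('i \<times> 'b) option" where
  "wedge_map p = (\<lambda>(i, x). if x = p i then None else Some (i, x))"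

definition wedge_sum ::
  "('i \<Rightarrow> 'b topology) \<Rightarrow> ('i \<Rightarrow> 'b) \<Rightarrow> 'i set \<Rightarrow> ('i \<times> 'b) option topology" where
  "wedge_sum X p I = topology (\<lambda>U.
     U \<subseteq> insert None (wedge_map p ` topspace (sum_topology X I)) \<and>
     openin (sum_topology X I) {z \<in> topspace (sum_topology X I). wedge_map p z \<in> U})"

lemma istopology_wedge_sum:
  "istopology (\<lambda>U.
     U \<subseteq> insert None (wedge_map p ` topspace (sum_topology X I)) \<and>
     openin (sum_topology X I) {z \<in> topspace (sum_topology X I). wedge_map p z \<in> U})"
proof -
  let ?S = "sum_topology X I"
  have 1: "{z \<in> topspace ?S. wedge_map p z \<in> U \<inter> V} =
      {z \<in> topspace ?S. wedge_map p z \<in> U} \<inter> {z \<in> topspace ?S. wedge_map p z \<in> V}" for U V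
    by blast
  have 2: "{z \<in> topspace ?S. wedge_map p z \<in> \<Union>\<K>} =
      (\<Union>U\<in>\<K>. {z \<in> topspace ?S. wedge_map p z \<in> U})" for \<K>
    by blast
  show ?thesis
    unfolding istopology_def
  proof (rule conjI; intro allI impI conjI)
    fix U V
    assume U: "U \<subseteq> insert None (wedge_map p ` topspace ?S) \<and>
        openin ?S {z \<in> topspace ?S. wedge_map p z \<in> U}"
      and V: "V \<subseteq> insert None (wedge_map p ` topspace ?S) \<and>
        openin ?S {z \<in> topspace ?S. wedge_map p z \<in> V}"
    show "U \<inter> V \<subseteq> insert None (wedge_map p ` topspace ?S)"
      using U by blast
    show "openin ?S {z \<in> topspace ?S. wedge_map p z \<in> U \<inter> V}"
      unfolding 1 using U V by (blast intro: openin_Int)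
  next
    fix \<K>
    assume K: "\<forall>K\<in>\<K>. K \<subseteq> insert None (wedge_map p ` topspace ?S) \<and>
        openin ?S {z \<in> topspace ?S. wedge_map p z \<in> K}"
    show "\<Union>\<K> \<subseteq> insert None (wedge_map p ` topspace ?S)"
      using K by blast
    show "openin ?S {z \<in> topspace ?S. wedge_map p z \<in> \<Union>\<K>}"
      unfolding 2 using K by (blast intro: openin_Union)
  qed
qed

lemma openin_wedge_sum:
  "openin (wedge_sum X p I) U \<longleftrightarrow>
     U \<subseteq> insert None (wedge_map p ` topspace (sum_topology X I)) \<and>
     openin (sum_topology X I) {z \<in> topspace (sum_topology X I). wedge_map p z \<in> U}"
  unfolding wedge_sum_def topology_inverse' [OF istopology_wedge_sum] by (rule refl)

lemma topspace_wedge_sum: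
  "topspace (wedge_sum X p I) = insert None (wedge_map p ` topspace (sum_topology X I))"
proof -
  let ?S = "sum_topology X I"
  let ?W = "insert None (wedge_map p ` topspace ?S)"
  have "{z \<in> topspace ?S. wedge_map p z \<in> ?W} = topspace ?S"
    by blast
  then have "openin (wedge_sum X p I) ?W"
    by (simp only: openin_wedge_sum openin_topspace simp_thms subset_refl)
  then show ?thesis
    using openin_subset openin_wedge_sum [of X p I "topspace (wedge_sum X p I)"] by blast
qed

lemma quotient_map_wedge_sum:
  assumes "I \<noteq> {}" and "\<And>i. i \<in> I \<Longrightarrow> p i \<in> topspace (X i)"
  shows "quotient_map (sum_topology X I) (wedge_sum X p I) (wedge_map p)"
proof -
  obtain i where "i \<in> I" using assms(1) by blast
  then have "(i, p i) \<in> topspace (sum_topology X I)" "wedge_map p (i, p i) = None"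
    using assms(2) by (auto simp: wedge_map_def)
  then have "None \<in> wedge_map p ` topspace (sum_topology X I)"
    by (metis imageI)
  then show ?thesis
    unfolding quotient_map_def topspace_wedge_sum openin_wedge_sum by blast
qed

definition sphere_base :: "nat \<Rightarrow> real" where
  "sphere_base = (\<lambda>i. if i = 0 then 1 else 0)"

lemma sphere_base_in_nsphere: "sphere_base \<in> topspace (nsphere n)"
  by (simp add: sphere_base_def nsphere topspace_Euclidean_space if_distrib [of "\<lambda>x. x ^ 2"]
      cong: if_cong)

definition wedge_of_spheres :: "nat \<Rightarrow> nat \<Rightarrow> (nat \<times> (nat \<Rightarrow> real)) option topology" where
  "wedge_of_spheres n k = wedge_sum (\<lambda>_. nsphere n) (\<lambda>_. sphere_base) {..<k}"

end

theory Submission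
  imports Defs
begin

text \<open>The simplices of the line clique complex are the subsets of stars of vertices and of triangles of
  the graph.  Removing simplicial vertices one at a time, one finds a set of triangles that, together with
  all stars, forms a contractible subcomplex: each simplex is attached along a cone.  Every other
  triangle has its boundary in this subcomplex, since any two of its edges lie in a star, and
  collapsing the subcomplex turns each of these triangles into a 2-sphere.\<close>

section \<open>Realizations inside a fixed vertex set\<close>

text \<open>When a simplicial vertex \<open>v\<close> is put back, the star of each further
  neighbour \<open>b\<close> gains the edge \<open>{v, b}\<close>, which so far lies only in the
  star of \<open>v\<close>. Attaching the larger star directly would glue a simplex along two
  disjoint pieces, the old star of \<open>b\<close> and the point \<open>{v, b}\<close>, and would
  create a loop. The triangle on \<open>v\<close>, \<open>p\<close>, \<open>b\<close> joins this
  point to the old edge \<open>{p, b}\<close> and turns the intersection into a cone. That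
  \<open>{p, b}\<close> is an edge at all is where chordality enters, through simpliciality of
  \<open>v\<close>.

  The spheres have dimension 2 because a triangle of the graph is a 2-simplex whose vertices are its
  edges. Collapsing the subcomplex preserves the homotopy type once its contraction extends to the
  whole complex. This extension is written down explicitly in barycentric coordinates, and so is the
  identification of a triangle modulo its boundary with a sphere.\<close>

definition realization :: "'b set \<Rightarrow> 'b set set \<Rightarrow> ('b \<Rightarrow> real) topology" where
  "realization U K = subtopology (powertop_real U)
     {x. (\<forall>v\<in>U. 0 \<le> x v) \<and> {v \<in> U. x v \<noteq> 0} \<in> K \<and> (\<Sum>v\<in>U. x v) = 1}"

definition down_closed :: "'b set set \<Rightarrow> bool" where
  "down_closed K \<longleftrightarrow> (\<forall>S\<in>K. \<forall>S'. S' \<subseteq> S \<longrightarrow> S' \<in> K)"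

lemma down_closedD: "down_closed K \<Longrightarrow> S \<in> K \<Longrightarrow> S' \<subseteq> S \<Longrightarrow> S' \<in> K"
  by (auto simp: down_closed_def)

lemma geometric_realization_eq: "geometric_realization K = realization (\<Union>K) K"
  by (simp add: geometric_realization_def realization_def)

lemma topspace_realization:
  "x \<in> topspace (realization U K) \<longleftrightarrow> x \<in> extensional U \<and>
     (\<forall>v\<in>U. 0 \<le> x v) \<and> {v \<in> U. x v \<noteq> 0} \<in> K \<and> (\<Sum>v\<in>U. x v) = 1"
  by (auto simp: realization_def PiE_UNIV_domain PiE_def)

lemma continuous_map_realization_coordinate:
  assumes "i \<in> U"
  shows "continuous_map (realization U K) euclideanreal (\<lambda>x. x i)"
  unfolding realization_def
  by (intro continuous_map_from_subtopology continuous_map_product_projection assms)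

lemma continuous_map_into_realization_coordinate:
  assumes "continuous_map Z (realization U K) f" "i \<in> U"
  shows "continuous_map Z euclideanreal (\<lambda>z. f z i)"
  using continuous_map_compose [OF assms(1) continuous_map_realization_coordinate [OF assms(2)]]
  by (simp add: o_def)

lemma continuous_map_into_realization:
  assumes "\<And>z. z \<in> topspace Z \<Longrightarrow> f z \<in> topspace (realization U K)"
    and "\<And>i. i \<in> U \<Longrightarrow> continuous_map Z euclideanreal (\<lambda>z. f z i)"
  shows "continuous_map Z (realization U K) f"
  unfolding realization_def continuous_map_in_subtopology continuous_map_componentwise
  using assms by (auto simp: topspace_realization)

text \<open>The ambient set \<open>U\<close> of coordinates stays fixed while the complex grows, so
  inclusions of subcomplexes are plain identities on functions.\<close>

lemma continuous_map_realization_mono: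
  assumes "K \<subseteq> K'"
  shows "continuous_map (realization U K) (realization U K') id"
  by (rule continuous_map_into_realization)
    (use assms in \<open>auto simp: topspace_realization intro: continuous_map_realization_coordinate\<close>)

text \<open>The support of a convex combination lies in the union of the two supports; if that union
  is a simplex, the whole segment stays in the realization.\<close>

lemma realization_straight_line_homotopic:
  assumes K: "down_closed K"
    and f: "continuous_map Z (realization U K) f"
    and g: "continuous_map Z (realization U K) g"
    and fg: "\<And>z. z \<in> topspace Z \<Longrightarrow> {v \<in> U. f z v \<noteq> 0} \<union> {v \<in> U. g z v \<noteq> 0} \<in> K"
  shows "homotopic_with (\<lambda>x. True) Z (realization U K) f g"
proof -
  let ?h = "\<lambda>(t, z). \<lambda>i\<in>U. (1 - t) * f z i + t * g z i"
  have fT: "f z \<in> topspace (realization U K)" and gT: "g z \<in> topspace (realization U K)"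
    if "z \<in> topspace Z" for z
    using f g that by (auto simp: continuous_map_def)
  have "continuous_map (prod_topology (top_of_set {0..1::real}) Z) (realization U K) ?h"
  proof (rule continuous_map_into_realization)
    fix p
    assume "p \<in> topspace (prod_topology (top_of_set {0..1::real}) Z)"
    then obtain t z where p: "p = (t, z)" and t: "0 \<le> t" "t \<le> 1" and z: "z \<in> topspace Z"
      by auto
    have fz: "f z \<in> extensional U" "\<forall>v\<in>U. 0 \<le> f z v" "(\<Sum>v\<in>U. f z v) = 1"
      using fT[OF z] by (auto simp: topspace_realization)
    have gz: "g z \<in> extensional U" "\<forall>v\<in>U. 0 \<le> g z v" "(\<Sum>v\<in>U. g z v) = 1"
      using gT[OF z] by (auto simp: topspace_realization)
    have "(\<Sum>v\<in>U. (1 - t) * f z v + t * g z v) = 1"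
      by (simp add: sum.distrib flip: sum_distrib_left) (simp add: fz gz)
    moreover have "{v \<in> U. (1 - t) * f z v + t * g z v \<noteq> 0} \<in> K"
      by (rule down_closedD [OF K fg[OF z]]) auto
    moreover have "{v \<in> U. ?h p v \<noteq> 0} = {v \<in> U. (1 - t) * f z v + t * g z v \<noteq> 0}"
      by (auto simp: p)
    ultimately show "?h p \<in> topspace (realization U K)"
      unfolding topspace_realization p using t fz gz by auto
  next
    fix i assume "i \<in> U"
    have 1: "continuous_map (prod_topology (top_of_set {0..1}) Z) euclideanreal fst"
      using continuous_map_fst continuous_map_into_fulltopology by blast
    have "continuous_map (prod_topology (top_of_set {0..1}) Z) euclideanreal
       (\<lambda>p. (1 - fst p) * f (snd p) i + fst p * g (snd p) i)"
      using continuous_map_compose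
        [OF continuous_map_snd continuous_map_into_realization_coordinate[OF f \<open>i \<in> U\<close>]]
        continuous_map_compose
        [OF continuous_map_snd continuous_map_into_realization_coordinate[OF g \<open>i \<in> U\<close>]]
      by (intro continuous_intros 1) (auto simp: o_def)
    then show "continuous_map (prod_topology (top_of_set {0..1}) Z) euclideanreal (\<lambda>z. ?h z i)"
      using \<open>i \<in> U\<close> by (simp add: case_prod_unfold)
  qed
  moreover have "?h (0, z) = f z" "?h (1, z) = g z" if "z \<in> topspace Z" for z
    using fT[OF that] gT[OF that] by (auto simp: topspace_realization restrict_def extensional_def)
  ultimately show ?thesis
    by (subst homotopic_with) auto
qed

text \<open>\<open>f\<close> factors through the contractible \<open>A\<close>, so it is
  null-homotopic as a map from \<open>X\<close> to \<open>X\<close>; this is concatenated with the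
  homotopy from \<open>id\<close> to \<open>f\<close>.\<close>

lemma contractible_space_deformation:
  assumes f: "continuous_map X A f" and i: "continuous_map A X id"
    and h: "homotopic_with (\<lambda>x. True) X X id f" and A: "contractible_space A"
  shows "contractible_space X"
proof -
  obtain a where "homotopic_with (\<lambda>x. True) A A id (\<lambda>x. a)"
    using A by (auto simp: contractible_space_def)
  then have "homotopic_with (\<lambda>x. True) X A (id \<circ> f) ((\<lambda>x. a) \<circ> f)"
    by (rule homotopic_with_compose_continuous_map_right [OF _ f]) auto
  then have "homotopic_with (\<lambda>x. True) X X (id \<circ> (id \<circ> f)) (id \<circ> ((\<lambda>x. a) \<circ> f))"
    by (rule homotopic_with_compose_continuous_map_left [OF _ i]) auto
  then have "homotopic_with (\<lambda>x. True) X X f (\<lambda>x. a)"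
    by (simp add: o_def id_def)
  then show ?thesis
    using h homotopic_with_trans unfolding contractible_space_def by blast
qed

lemma continuous_map_real_Min:
  assumes "finite I" "I \<noteq> {}" "\<And>i. i \<in> I \<Longrightarrow> continuous_map X euclideanreal (f i)"
  shows "continuous_map X euclideanreal (\<lambda>x. Min ((\<lambda>i. f i x) ` I))"
  using assms
proof (induction I rule: finite_ne_induct)
  case (insert i I)
  then have "continuous_map X euclideanreal (\<lambda>x. min (f i x) (Min ((\<lambda>i. f i x) ` I)))"
    by (intro continuous_intros) auto
  then show ?case
    using insert by (simp add: Min_insert)
qed auto

text \<open>The retraction moves mass \<open>min (x i) (t x)\<close> from every other vertex \<open>i\<close> of \<open>\<sigma>\<close> to the
  apex \<open>w\<close>, where \<open>t x\<close> is the smallest mass that \<open>x\<close> has outside of a face of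
  \<open>\<sigma>\<close> in \<open>K\<close>, not counting \<open>w\<close>.  A face at which the minimum is attained then
  carries, together with \<open>w\<close>, all that is left.\<close>

lemma contractible_realization_Un_Pow:
  assumes U: "finite U" and K: "down_closed K" and ne: "{} \<in> K"
    and \<sigma>: "\<sigma> \<subseteq> U" and w: "w \<in> \<sigma>"
    and cone: "\<And>S. S \<in> K \<Longrightarrow> S \<subseteq> \<sigma> \<Longrightarrow> insert w S \<in> K"
    and contr: "contractible_space (realization U K)"
  shows "contractible_space (realization U (K \<union> Pow \<sigma>))"
proof -
  let ?K' = "K \<union> Pow \<sigma>"
  let ?X = "realization U ?K'"
  have fin\<sigma>: "finite \<sigma>"
    using U \<sigma> finite_subset by blast
  define F where "F = {S \<in> K. S \<subseteq> \<sigma>}"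
  have F: "finite F" "F \<noteq> {}"
    using fin\<sigma> ne by (auto simp: F_def)
  define t where "t x = Min ((\<lambda>S. \<Sum>i\<in>\<sigma> - S - {w}. x i) ` F)" for x :: "'a \<Rightarrow> real"
  define f where "f x = (\<lambda>i\<in>U. if i = w then x w + (\<Sum>j\<in>\<sigma> - {w}. min (x j) (t x))
     else if i \<in> \<sigma> then x i - min (x i) (t x) else x i)" for x :: "'a \<Rightarrow> real"
  have K': "down_closed ?K'"
    using K by (auto simp: down_closed_def)
  have t0: "0 \<le> t x" if "x \<in> topspace ?X" for x
    unfolding t_def using F that \<sigma>
    by (subst Min_ge_iff) (auto simp: topspace_realization intro!: sum_nonneg)
  \<comment> \<open>Nothing moves on \<open>K\<close>: the part of the support inside \<sigma> is
    itself a face in \<open>F\<close>, and \<sigma> carries no mass outside it, so the minimum is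
    zero.\<close>
  have fid: "f x = x" if x: "x \<in> topspace ?X" and S: "{v \<in> U. x v \<noteq> 0} \<in> K" for x
  proof -
    let ?S = "{v \<in> U. x v \<noteq> 0} \<inter> \<sigma>"
    have SF: "?S \<in> F"
      using K S by (auto simp: F_def intro: down_closedD)
    have "(\<Sum>i\<in>\<sigma> - ?S - {w}. x i) = 0"
      using \<sigma> by (intro sum.neutral) auto
    then have "t x \<le> 0"
      unfolding t_def using SF F by (metis (no_types, lifting) Min_le finite_imageI image_eqI)
    with t0[OF x] have "t x = 0" by simp
    moreover have "min (x j) 0 = 0" if "j \<in> U" for j
      using x that by (auto simp: topspace_realization)
    ultimately show ?thesis
      using x w \<sigma> unfolding f_def
      by (auto simp: topspace_realization restrict_def extensional_def fun_eq_iff intro!: sum.neutral)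
  qed
  have fsup: "{v \<in> U. f x v \<noteq> 0} \<in> K \<and> {v \<in> U. f x v \<noteq> 0} \<subseteq> \<sigma>"
    if x: "x \<in> topspace ?X" and S: "{v \<in> U. x v \<noteq> 0} \<subseteq> \<sigma>" for x
  proof -
    have "t x \<in> (\<lambda>S. \<Sum>i\<in>\<sigma> - S - {w}. x i) ` F"
      unfolding t_def using F by (intro Min_in) auto
    then obtain S where SF: "S \<in> F" and tS: "t x = (\<Sum>i\<in>\<sigma> - S - {w}. x i)" by auto
    have pos: "0 \<le> x i" if "i \<in> U" for i
      using x that by (auto simp: topspace_realization)
    \<comment> \<open>One nonnegative mass is at most the sum \<open>t x\<close> in which it occurs,
      so all of it is moved to \<open>w\<close>.\<close>
    have "x i \<le> t x" if "i \<in> \<sigma> - S - {w}" for i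
      unfolding tS using that fin\<sigma> pos \<sigma> by (intro member_le_sum) auto
    then have "f x i = 0" if "i \<in> U" "i \<notin> insert w S" for i
      using that S by (auto simp: f_def min_def)
    then have "{v \<in> U. f x v \<noteq> 0} \<subseteq> insert w S" by blast
    moreover have "insert w S \<in> K" "insert w S \<subseteq> \<sigma>"
      using cone SF w by (auto simp: F_def)
    ultimately show ?thesis
      using down_closedD[OF K] by blast
  qed
  have fK: "f x \<in> topspace (realization U K)" if x: "x \<in> topspace ?X" for x
  proof -
    have pos: "0 \<le> x i" if "i \<in> U" for i
      using x that by (auto simp: topspace_realization)
    have "0 \<le> f x i" if "i \<in> U" for i
      using that pos t0[OF x] w \<sigma> by (auto simp: f_def subset_iff intro!: add_nonneg_nonneg sum_nonneg)
    moreover have "(\<Sum>v\<in>U. f x v) = 1"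
    proof -
      have split: "sum g U = g w + sum g (\<sigma> - {w}) + sum g (U - \<sigma>)" for g :: "'a \<Rightarrow> real"
        using sum.subset_diff[OF \<sigma> U, of g] sum.remove[OF fin\<sigma> w, of g] by linarith
      have "sum (f x) (\<sigma> - {w}) = (\<Sum>i\<in>\<sigma> - {w}. x i - min (x i) (t x))"
        using \<sigma> by (intro sum.cong) (auto simp: f_def)
      moreover have "sum (f x) (U - \<sigma>) = sum x (U - \<sigma>)"
        using w by (intro sum.cong) (auto simp: f_def)
      moreover have "f x w = x w + (\<Sum>j\<in>\<sigma> - {w}. min (x j) (t x))"
        using w \<sigma> by (auto simp: f_def)
      ultimately have "sum (f x) U = sum x U"
        using split[of x] split[of "f x"] by (simp add: sum_subtractf)
      then show ?thesis using x by (simp add: topspace_realization)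
    qed
    moreover have "{v \<in> U. f x v \<noteq> 0} \<in> K"
    proof (cases "{v \<in> U. x v \<noteq> 0} \<in> K")
      case True
      then show ?thesis using fid[OF x True] by simp
    next
      case False
      then show ?thesis using fsup x by (auto simp: topspace_realization)
    qed
    ultimately show ?thesis
      by (auto simp: topspace_realization f_def)
  qed
  have ct: "continuous_map ?X euclideanreal t"
    unfolding t_def using F \<sigma> fin\<sigma>
    by (intro continuous_map_real_Min continuous_map_sum continuous_map_realization_coordinate) auto
  have fcont: "continuous_map ?X (realization U K) f"
  proof (rule continuous_map_into_realization [OF fK])
    fix i assume i: "i \<in> U"
    have *: "continuous_map ?X euclideanreal (\<lambda>x. x w + (\<Sum>j\<in>\<sigma> - {w}. min (x j) (t x)))"
      using w \<sigma> fin\<sigma> by (intro continuous_intros continuous_map_realization_coordinate ct) auto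
    have **: "continuous_map ?X euclideanreal (\<lambda>x. x i - min (x i) (t x))"
      using i by (intro continuous_intros continuous_map_realization_coordinate ct) auto
    show "continuous_map ?X euclideanreal (\<lambda>x. f x i)"
      using i * ** continuous_map_realization_coordinate[OF i]
      by (cases "i = w"; cases "i \<in> \<sigma>") (simp_all add: f_def)
  qed
  have "homotopic_with (\<lambda>x. True) ?X ?X id f"
  proof (rule realization_straight_line_homotopic [OF K'])
    show "continuous_map ?X ?X f"
      using continuous_map_compose[OF fcont continuous_map_realization_mono[of K ?K' U]]
      by (simp add: id_def o_def)
    \<comment> \<open>Either \<open>x\<close> is fixed, or the supports of both ends of the segment
      lie in the simplex \<sigma>.\<close>
    show "{v \<in> U. id x v \<noteq> 0} \<union> {v \<in> U. f x v \<noteq> 0} \<in> ?K'" if x: "x \<in> topspace ?X" for x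
    proof (cases "{v \<in> U. x v \<noteq> 0} \<in> K")
      case True
      then show ?thesis using fid[OF x True] by simp
    next
      case False
      then show ?thesis using fsup[OF x] x by (auto simp: topspace_realization)
    qed
  qed auto
  then show ?thesis
    using contractible_space_deformation[OF fcont continuous_map_realization_mono[of K ?K' U]] contr
    by auto
qed

section \<open>Simplicial vertices of chordal graphs\<close>

text \<open>Cutting out the part of a walk between two positions shortens it. The cut is possible at
  a forward chord, which excludes all but single steps, and at a repeated vertex, which gives
  distinctness.\<close>

lemma shortest_walk_induced:
  assumes ne: "xs \<noteq> []" and walk: "successively R xs" 
    and min: "\<And>ys. \<lbrakk>ys \<noteq> []; successively R ys; set ys \<subseteq> set xs; hd ys = hd xs; last ys = last xs\<rbrakk>
                 \<Longrightarrow> length xs \<le> length ys"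
  shows "distinct xs" 
    and "\<And>i j. \<lbrakk>i < j; j < length xs; R (xs ! i) (xs ! j)\<rbrakk> \<Longrightarrow> j = Suc i"
proof -
  have glue: "successively R (take (Suc i) xs @ drop j xs)"
    if "i < j" "j < length xs" "R (xs ! i) (xs ! j)" for i j
  proof -
    have "successively R (take (Suc i) xs)" "successively R (drop j xs)"
      using walk by (metis append_take_drop_id successively_append_iff)+
    moreover have "last (take (Suc i) xs) = xs ! i" "hd (drop j xs) = xs ! j"
      using that by (auto simp: take_Suc_conv_app_nth hd_drop_conv_nth)
    ultimately show ?thesis
      using that by (simp add: successively_append_iff)
  qed
  show "j = Suc i" if "i < j" "j < length xs" "R (xs ! i) (xs ! j)" for i j
  proof -
    let ?ys = "take (Suc i) xs @ drop j xs"
    have "hd ?ys = hd xs" "last ?ys = last xs"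
      using that ne by (auto simp: hd_append)
    moreover have "set ?ys \<subseteq> set xs"
      by (auto dest: in_set_takeD in_set_dropD)
    ultimately have "length xs \<le> length ?ys"
      using min[of ?ys] glue[OF that] ne that by auto
    then show ?thesis using that by simp
  qed
  show "distinct xs"
  proof (rule ccontr)
    assume "\<not> distinct xs"
    then obtain i j where ij: "i < j" "j < length xs" "xs ! i = xs ! j"
      unfolding distinct_conv_nth by (metis linorder_neqE_nat)
    \<comment> \<open>One copy of the repeated vertex is dropped as well, so the junction is the old
      step from position \<open>i - 1\<close> to \<open>i\<close>; for \<open>i = 0\<close> the
      first part is empty.\<close>
    let ?ys = "take i xs @ drop j xs"
    have "successively R (take i xs)" "successively R (drop j xs)"
      using walk by (metis append_take_drop_id successively_append_iff)+
    moreover have "R (last (take i xs)) (hd (drop j xs))" if i0: "i \<noteq> 0"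
    proof -
      obtain k where k: "i = Suc k" using i0 by (cases i) auto
      have "last (take i xs) = xs ! k" 
        using ij k by (auto simp: take_Suc_conv_app_nth)
      moreover have "R (xs ! k) (xs ! i)"
        using walk ij(1,2) k by (auto simp: successively_conv_nth)
      ultimately show ?thesis using ij by (simp add: hd_drop_conv_nth)
    qed
    ultimately have "successively R ?ys"
      by (auto simp: successively_append_iff)
    moreover have "hd ?ys = hd xs"
      using ij ne by (cases "i = 0") (auto simp: hd_append hd_drop_conv_nth hd_conv_nth)
    moreover have "last ?ys = last xs"
      using ij by auto
    moreover have "set ?ys \<subseteq> set xs"
      by (auto dest: in_set_takeD in_set_dropD)
    ultimately have "length xs \<le> length ?ys"
      using min[of ?ys] ij by auto
    then show False using ij by simp
  qed
qed

lemma rtranclp_imp_walk: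
  assumes "R\<^sup>*\<^sup>* x y"
  shows "\<exists>xs. xs \<noteq> [] \<and> successively R xs \<and> hd xs = x \<and> last xs = y"
  using assms
proof (induction rule: rtranclp_induct)
  case base
  show ?case by (rule exI[of _ "[x]"]) auto
next
  case (step y z)
  then obtain xs where xs: "xs \<noteq> []" "successively R xs" "hd xs = x" "last xs = y" by blast
  then show ?case
    using step by (intro exI[of _ "xs @ [z]"]) (auto simp: successively_append_iff)
qed

lemma ex_shortest_walk:
  assumes "R\<^sup>*\<^sup>* x y"
  obtains xs where "xs \<noteq> []" "successively R xs" "hd xs = x" "last xs = y" "distinct xs"
    "\<And>i j. \<lbrakk>i < j; j < length xs; R (xs ! i) (xs ! j)\<rbrakk> \<Longrightarrow> j = Suc i"
proof -
  let ?P = "\<lambda>xs. xs \<noteq> [] \<and> successively R xs \<and> hd xs = x \<and> last xs = y"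
  let ?xs = "arg_min length ?P"
  have P: "?P ?xs" and m: "?P ys \<Longrightarrow> length ?xs \<le> length ys" for ys
    using arg_min_nat_lemma[of ?P _ length] rtranclp_imp_walk[OF assms] by blast+
  show ?thesis
    using that[of ?xs] P m shortest_walk_induced[of ?xs R] by auto
qed

definition simplicial_vertex :: "'a set \<Rightarrow> 'a set set \<Rightarrow> 'a \<Rightarrow> bool" where
  "simplicial_vertex V E v \<longleftrightarrow> v \<in> V \<and>
     (\<forall>x y. {v, x} \<in> E \<longrightarrow> {v, y} \<in> E \<longrightarrow> x \<noteq> y \<longrightarrow> {x, y} \<in> E)"

lemma simple_graph_no_loop: "simple_graph V E \<Longrightarrow> {x} \<notin> E" "simple_graph V E \<Longrightarrow> {x, x} \<notin> E"
  by (auto simp: simple_graph_def)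

lemma simple_graph_vertex: "simple_graph V E \<Longrightarrow> {x, y} \<in> E \<Longrightarrow> x \<in> V \<and> y \<in> V"
  by (auto simp: simple_graph_def)

lemma simple_graph_induced:
  "simple_graph V E \<Longrightarrow> W \<subseteq> V \<Longrightarrow> simple_graph W {e \<in> E. e \<subseteq> W}"
  by (auto simp: simple_graph_def finite_subset)

lemma chordal_induced:
  assumes "chordal V E" "W \<subseteq> V"
  shows "chordal W {e \<in> E. e \<subseteq> W}"
proof -
  have "induced_cycle V E c" if "induced_cycle W {e \<in> E. e \<subseteq> W} c" for c
  proof -
    have "{c ! i, c ! j} \<subseteq> W" if "i < length c" "j < length c" for i j
      using that \<open>induced_cycle W _ c\<close> nth_mem by (fastforce simp: induced_cycle_def)
    then show ?thesis
      using that assms(2) by (auto simp: induced_cycle_def)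
  qed
  then show ?thesis
    using assms(1) by (auto simp: chordal_def)
qed

text \<open>A shortest path from \<open>s\<close> to \<open>s'\<close> through \<open>A\<close>, closed up by \<open>b\<close>, has no chords.\<close>

lemma chordal_separator_adjacent:
  assumes G: "simple_graph V E" and ch: "chordal V E"
    and conn: "\<And>x y. x \<in> A \<Longrightarrow> y \<in> A \<Longrightarrow> (\<lambda>x y. x \<in> A \<and> y \<in> A \<and> {x, y} \<in> E)\<^sup>*\<^sup>* x y"
    and s: "s \<notin> A" "x \<in> A" "{s, x} \<in> E" and s': "s' \<notin> A" "x' \<in> A" "{s', x'} \<in> E" "s \<noteq> s'"
    and b: "{b, s} \<in> E" "{b, s'} \<in> E" "b \<notin> A" "\<And>a. a \<in> A \<Longrightarrow> {b, a} \<notin> E"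
  shows "{s, s'} \<in> E"
proof (rule ccontr)
  assume ns: "{s, s'} \<notin> E"
  define W where "W = insert s (insert s' A)"
  define R where "R x y \<longleftrightarrow> x \<in> W \<and> y \<in> W \<and> {x, y} \<in> E" for x y
  have "R\<^sup>*\<^sup>* x x'"
    using conn[OF s(2) s'(2)]
    by (rule rtranclp_mono[THEN predicate2D, rotated]) (auto simp: R_def W_def)
  moreover have "R s x" "R x' s'"
    using s s' by (auto simp: R_def W_def insert_commute)
  ultimately have "R\<^sup>*\<^sup>* s s'"
    by (meson converse_rtranclp_into_rtranclp rtranclp.rtrancl_into_rtrancl)
  then obtain xs where xs: "xs \<noteq> []" "successively R xs" "hd xs = s" "last xs = s'" "distinct xs"
    and ind: "\<And>i j. \<lbrakk>i < j; j < length xs; R (xs ! i) (xs ! j)\<rbrakk> \<Longrightarrow> j = Suc i"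
    using ex_shortest_walk by metis
  define n where "n = length xs"
  have x0: "xs ! 0 = s" and xn: "xs ! (n - 1) = s'"
    using xs by (auto simp: n_def hd_conv_nth last_conv_nth)
  have step: "R (xs ! i) (xs ! Suc i)" if "Suc i < n" for i
    using that xs by (auto simp: successively_conv_nth n_def)
  have n0: "0 < n" using xs by (auto simp: n_def)
  \<comment> \<open>The path needs at least three vertices, so that adding \<open>b\<close> gives a
    cycle of length at least 4, which chordality forbids.\<close>
  have "n \<noteq> 1" using x0 xn s' by auto
  moreover have "n \<noteq> 2" using step[of 0] x0 xn ns by (auto simp: R_def)
  ultimately have n3: "3 \<le> n" using n0 by linarith
  have W: "xs ! i \<in> W" if "i < n" for i
  proof (cases "Suc i < n")
    case True
    then show ?thesis using step[of i] by (simp add: R_def)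
  next
    case False
    then have "i = n - 1" using that by linarith
    then show ?thesis using xn by (simp add: W_def)
  qed
  have inA: "xs ! i \<in> A" if "i < n" "i \<noteq> 0" "Suc i \<noteq> n" for i
  proof -
    have "xs ! i \<noteq> xs ! 0" "xs ! i \<noteq> xs ! (n - 1)"
      using that xs(5) n0 by (auto simp: nth_eq_iff_index_eq n_def)
    then show ?thesis using W[OF that(1)] unfolding x0 xn W_def by blast
  qed
  have bW: "b \<notin> W"
    using b simple_graph_no_loop[OF G] by (auto simp: W_def)
  have adj: "{xs ! i, xs ! j} \<in> E \<longleftrightarrow> j = Suc i \<or> i = Suc j" if "i < n" "j < n" for i j
  proof
    assume e: "{xs ! i, xs ! j} \<in> E"
    then have "i \<noteq> j" using simple_graph_no_loop[OF G] by auto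
    moreover have "R (xs ! i) (xs ! j)" "R (xs ! j) (xs ! i)"
      using e W that by (auto simp: R_def insert_commute)
    ultimately show "j = Suc i \<or> i = Suc j"
      using ind that by (metis linorder_neqE_nat n_def)
  next
    assume "j = Suc i \<or> i = Suc j"
    then show "{xs ! i, xs ! j} \<in> E"
      using step that by (auto simp: R_def insert_commute)
  qed
  \<comment> \<open>Inner vertices of the path lie in \<open>A\<close>, where \<open>b\<close> has
    no neighbour.\<close>
  have badj: "{b, xs ! i} \<in> E \<longleftrightarrow> i = 0 \<or> Suc i = n" if "i < n" for i
    using inA[OF that] b x0 xn by force
  have wV: "W \<subseteq> V"
  proof -
    have "s \<in> V" "s' \<in> V" using s s' simple_graph_vertex[OF G] by auto
    moreover have "a \<in> V" if "a \<in> A" for a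
      using conn[OF that s(2)] s simple_graph_vertex[OF G]
      by (cases rule: converse_rtranclpE) blast+
    ultimately show ?thesis by (auto simp: W_def)
  qed
  let ?c = "b # xs"
  have len: "length ?c = Suc n" by (simp add: n_def)
  have "{?c ! i, ?c ! j} \<in> E \<longleftrightarrow> j = Suc i mod Suc n \<or> i = Suc j mod Suc n"
    if ij: "i < Suc n" "j < Suc n" for i j
  proof -
    \<comment> \<open>The wrap-around happens only at position \<open>n\<close>, the end
      \<open>s'\<close> of the path, and leads back to \<open>b\<close> at position 0.\<close>
    have m: "Suc k mod Suc n = (if k = n then 0 else Suc k)" if "k < Suc n" for k
      using that by auto
    show ?thesis
    proof (cases i; cases j)
      fix i' j' assume "i = Suc i'" "j = Suc j'"
      then show ?thesis using adj[of i' j'] ij m[of i] m[of j] by auto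
    next
      fix j' assume "i = 0" "j = Suc j'"
      then show ?thesis using badj[of j'] ij n3 m[of i] m[of j] by auto
    next
      fix i' assume "i = Suc i'" "j = 0"
      then show ?thesis using badj[of i'] ij n3 m[of i] m[of j] by (auto simp: insert_commute)
    next
      assume "i = 0" "j = 0"
      then show ?thesis using simple_graph_no_loop[OF G] n3 by auto
    qed
  qed
  moreover have "set xs \<subseteq> W" 
    using W by (auto simp: in_set_conv_nth n_def)
  moreover have "b \<in> V" using b simple_graph_vertex[OF G] by blast
  ultimately have "induced_cycle V E ?c"
    unfolding induced_cycle_def len using n3 xs(5) bW wV by auto
  then show False
    using ch n3 unfolding chordal_def by (metis len less_Suc_eq_le order.strict_trans2)
qed

text \<open>Dirac's theorem. A connected \<open>A\<close> is taken as large as possible among those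
  for which some vertex is neither in \<open>A\<close> nor adjacent to it. Maximality forces every
  vertex of \<open>B A\<close> to be adjacent to all of \<open>N A\<close>, and then chordality
  makes \<open>N A\<close> a clique. A simplicial vertex of the smaller graph on \<open>B A\<close>
  has its remaining neighbours in \<open>N A\<close>, so it is still simplicial in the whole
  graph.\<close>

lemma chordal_has_simplicial_vertex:
  assumes "simple_graph V E" "chordal V E" "V \<noteq> {}"
  shows "\<exists>v. simplicial_vertex V E v"
  using assms
proof (induction "card V" arbitrary: V E rule: less_induct)
  case less
  note G = \<open>simple_graph V E\<close>
  have finV: "finite V" using G by (simp add: simple_graph_def)
  show ?case
  proof (cases "\<forall>x\<in>V. \<forall>y\<in>V. x \<noteq> y \<longrightarrow> {x, y} \<in> E")
    case True
    then show ?thesis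
      using \<open>V \<noteq> {}\<close> simple_graph_vertex[OF G] unfolding simplicial_vertex_def by blast
  next
    case False
    then obtain a0 b0 where ab: "a0 \<in> V" "b0 \<in> V" "a0 \<noteq> b0" "{a0, b0} \<notin> E" by blast
    define N where "N A = {s \<in> V - A. \<exists>x\<in>A. {s, x} \<in> E}" for A
    define B where "B A = V - (A \<union> N A)" for A
    define P where "P A \<longleftrightarrow> A \<subseteq> V \<and> A \<noteq> {} \<and> B A \<noteq> {} \<and>
      (\<forall>x\<in>A. \<forall>y\<in>A. (\<lambda>x y. x \<in> A \<and> y \<in> A \<and> {x, y} \<in> E)\<^sup>*\<^sup>* x y)" for A
    have "P {a0}"
      using ab by (auto simp: P_def B_def N_def insert_commute)
    moreover have "\<forall>A. P A \<longrightarrow> card A \<le> card V"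
      using finV by (auto simp: P_def intro: card_mono)
    ultimately obtain A where A: "P A" and max: "\<And>A'. P A' \<Longrightarrow> card A' \<le> card A"
      using ex_has_greatest_nat[of P "{a0}" card "Suc (card V)"] less_Suc_eq_le by blast
    have AV: "A \<subseteq> V" "A \<noteq> {}" "B A \<noteq> {}"
      and conn: "\<And>x y. x \<in> A \<Longrightarrow> y \<in> A \<Longrightarrow> (\<lambda>x y. x \<in> A \<and> y \<in> A \<and> {x, y} \<in> E)\<^sup>*\<^sup>* x y"
      using A by (auto simp: P_def)
    have finA: "finite A" using AV finV finite_subset by blast
    have complete: "{b, s} \<in> E" if b: "b \<in> B A" and s: "s \<in> N A" for b s
    proof (rule ccontr)
      assume nb: "{b, s} \<notin> E"
      let ?A = "insert s A"
      obtain x where x: "x \<in> A" "{s, x} \<in> E" and sA: "s \<notin> A" "s \<in> V"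
        using s by (auto simp: N_def)
      let ?R = "\<lambda>x y. x \<in> ?A \<and> y \<in> ?A \<and> {x, y} \<in> E"
      have up: "?R\<^sup>*\<^sup>* u v" if "u \<in> A" "v \<in> A" for u v
        using conn[OF that] by (rule rtranclp_mono[THEN predicate2D, rotated]) auto
      have sx: "?R s x" "?R x s" using x by (auto simp: insert_commute)
      have "?R\<^sup>*\<^sup>* u v" if "u \<in> ?A" "v \<in> ?A" for u v
      proof -
        have "?R\<^sup>*\<^sup>* u x" 
          using that(1) up[OF _ x(1)] sx(1) by auto
        moreover have "?R\<^sup>*\<^sup>* x v"
          using that(2) up[OF x(1)] sx(2) by auto
        ultimately show ?thesis by (rule rtranclp_trans)
      qed
      \<comment> \<open>\<open>b\<close> is not adjacent to the added vertex \<open>s\<close>, so it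
        survives in \<open>B ?A\<close>, and the larger set contradicts maximality.\<close>
      moreover have "b \<in> B ?A"
        using b nb s sA x by (auto simp: B_def N_def)
      ultimately have "P ?A"
        using sA AV by (auto simp: P_def)
      from max[OF this] show False
        using sA finA by simp
    qed
    have sep: "{s, s'} \<in> E" if s: "s \<in> N A" "s' \<in> N A" "s \<noteq> s'" for s s'
    proof -
      obtain b where b: "b \<in> B A" using AV by blast
      obtain x x' where "x \<in> A" "{s, x} \<in> E" "x' \<in> A" "{s', x'} \<in> E" "s \<notin> A" "s' \<notin> A"
        using s by (auto simp: N_def)
      moreover have "b \<notin> A" "\<And>a. a \<in> A \<Longrightarrow> {b, a} \<notin> E"
        using b by (auto simp: B_def N_def)
      ultimately show ?thesis
        using chordal_separator_adjacent[OF G \<open>chordal V E\<close> conn] complete[OF b] s by metis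
    qed
    let ?E = "{e \<in> E. e \<subseteq> B A}"
    have BV: "B A \<subseteq> V" by (auto simp: B_def)
    have "card (B A) < card V"
      using AV finV by (intro psubset_card_mono) (auto simp: B_def)
    then obtain v where v: "simplicial_vertex (B A) ?E v"
      using less.hyps[of "B A" ?E] simple_graph_induced[OF G BV] chordal_induced[OF \<open>chordal V E\<close> BV]
        AV by auto
    have vB: "v \<in> B A" using v by (simp add: simplicial_vertex_def)
    have nb: "x \<in> B A \<or> x \<in> N A" if "{v, x} \<in> E" for x
      using that vB simple_graph_vertex[OF G that] by (auto simp: B_def N_def)
    have "{x, y} \<in> E" if xy: "{v, x} \<in> E" "{v, y} \<in> E" "x \<noteq> y" for x y
    proof -
      consider "x \<in> B A" "y \<in> B A" | "x \<in> B A" "y \<in> N A" | "x \<in> N A" "y \<in> B A" | "x \<in> N A" "y \<in> N A"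
        using nb xy by blast
      then show ?thesis
      proof cases
        case 1
        then show ?thesis using v xy vB unfolding simplicial_vertex_def by blast
      next
        case 3
        then show ?thesis using complete by (metis insert_commute)
      qed (use complete sep xy in auto)
    qed
    then show ?thesis
      using vB BV by (intro exI[of _ v]) (auto simp: simplicial_vertex_def)
  qed
qed

text \<open>A walk enters and leaves \<open>v\<close> by neighbours of \<open>v\<close>, which are
  equal or adjacent, so \<open>v\<close> can be bypassed.\<close>

lemma connected_graph_remove_simplicial:
  assumes G: "simple_graph V E" and conn: "connected_graph V E" and v: "simplicial_vertex V E v"
    and W: "V - {v} \<noteq> {}"
  shows "connected_graph (V - {v}) {e \<in> E. e \<subseteq> V - {v}}"
proof -
  let ?R = "\<lambda>x y. {x, y} \<in> {e \<in> E. e \<subseteq> V - {v}}"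
  have R: "?R x y" if "{x, y} \<in> E" "x \<noteq> v" "y \<noteq> v" for x y
    using that simple_graph_vertex[OF G that(1)] by auto
  \<comment> \<open>While the walk stands at \<open>v\<close>, the invariant remembers a neighbour
    of \<open>v\<close> that was reached without using \<open>v\<close>.\<close>
  have "(x \<noteq> v \<longrightarrow> ?R\<^sup>*\<^sup>* u x) \<and> (x = v \<longrightarrow> (\<exists>y. y \<noteq> v \<and> {v, y} \<in> E \<and> ?R\<^sup>*\<^sup>* u y))"
    if "(\<lambda>x y. {x, y} \<in> E)\<^sup>*\<^sup>* u x" "u \<noteq> v" for u x
    using that
  proof (induction rule: rtranclp_induct)
    case (step x z)
    show ?case
    proof (cases "x = v")
      case True
      then obtain y where y: "y \<noteq> v" "{v, y} \<in> E" "?R\<^sup>*\<^sup>* u y" using step by blast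
      have "z \<noteq> v" using step True simple_graph_no_loop[OF G] by auto
      moreover have "?R\<^sup>*\<^sup>* u z"
      proof (cases "y = z")
        case False
        then have "{y, z} \<in> E"
          using v y True step by (auto simp: simplicial_vertex_def)
        then show ?thesis using R y \<open>z \<noteq> v\<close> by (meson rtranclp.rtrancl_into_rtrancl)
      qed (use y in simp)
      ultimately show ?thesis by simp
    next
      case False
      then have ux: "?R\<^sup>*\<^sup>* u x" using step by blast
      show ?thesis
      proof (cases "z = v")
        case True
        then show ?thesis using ux False step by (auto simp: insert_commute)
      next
        case zv: False
        then show ?thesis using ux False R[OF step(2)] by (meson rtranclp.rtrancl_into_rtrancl)
      qed
    qed
  qed auto
  then show ?thesis
    using conn W unfolding connected_graph_def by blast
qed

section \<open>A contractible subcomplex of the line clique complex\<close>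

definition faces :: "'b set set \<Rightarrow> 'b set set" where
  "faces F = {S. \<exists>\<tau>\<in>F. S \<subseteq> \<tau>}"

lemma facesI: "\<tau> \<in> F \<Longrightarrow> S \<subseteq> \<tau> \<Longrightarrow> S \<in> faces F"
  by (auto simp: faces_def)

lemma down_closed_faces: "down_closed (faces F)"
  by (auto simp: down_closed_def faces_def)

lemma faces_subset: "(\<And>\<tau>. \<tau> \<in> F \<Longrightarrow> \<tau> \<in> faces F') \<Longrightarrow> faces F \<subseteq> faces F'"
  unfolding faces_def by (smt (verit) Collect_mono mem_Collect_eq subset_trans)

text \<open>Checking the cone condition on generators is enough: for \<open>S\<close> inside
  \<open>\<tau> \<inter> \<sigma>\<close>, the set \<open>insert w S\<close> is a subset of
  \<open>insert w (\<tau> \<inter> \<sigma>)\<close>.\<close>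

lemma contractible_realization_faces_insert:
  assumes "finite U" "F \<noteq> {}" "\<sigma> \<subseteq> U" "w \<in> \<sigma>"
    and cone: "\<And>\<tau>. \<tau> \<in> F \<Longrightarrow> insert w (\<tau> \<inter> \<sigma>) \<in> faces F"
    and contr: "contractible_space (realization U (faces F))"
  shows "contractible_space (realization U (faces (insert \<sigma> F)))"
proof -
  have "contractible_space (realization U (faces F \<union> Pow \<sigma>))"
  proof (rule contractible_realization_Un_Pow [OF \<open>finite U\<close> down_closed_faces _ assms(3,4) _ contr])
    fix S assume S: "S \<in> faces F" "S \<subseteq> \<sigma>"
    then obtain \<tau> where \<tau>: "\<tau> \<in> F" "S \<subseteq> \<tau>" by (auto simp: faces_def)
    show "insert w S \<in> faces F"
      by (rule down_closedD[OF down_closed_faces cone[OF \<tau>(1)]]) (use S \<tau> in auto)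
  qed (use \<open>F \<noteq> {}\<close> in \<open>auto simp: faces_def\<close>)
  moreover have "faces F \<union> Pow \<sigma> = faces (insert \<sigma> F)"
    by (auto simp: faces_def)
  ultimately show ?thesis by simp
qed

lemma contractible_realization_Pow:
  assumes "finite U" "e \<in> \<sigma>" "\<sigma> \<subseteq> U"
  shows "contractible_space (realization U (Pow \<sigma>))"
proof -
  let ?e = "\<lambda>i\<in>U. if i = e then 1 else (0::real)"
  have eU: "e \<in> U" using assms by blast
  have T: "?e \<in> topspace (realization U (Pow \<sigma>))"
  proof -
    have "(\<Sum>v\<in>U. ?e v) = (\<Sum>v\<in>U. if v = e then 1 else 0)"
      by (intro sum.cong) auto
    also have "\<dots> = 1" using eU \<open>finite U\<close> by simp
    finally show ?thesis using assms by (auto simp: topspace_realization)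
  qed
  have "homotopic_with (\<lambda>x. True) (realization U (Pow \<sigma>)) (realization U (Pow \<sigma>)) id (\<lambda>x. ?e)"
    by (rule realization_straight_line_homotopic)
      (use T in \<open>auto simp: down_closed_def topspace_realization\<close>)
  then show ?thesis
    unfolding contractible_space_def by blast
qed

section \<open>Stars and triangles as simplices on the set of edges\<close>

definition star :: "'a set set \<Rightarrow> 'a \<Rightarrow> 'a set set" where
  "star E v = {e \<in> E. v \<in> e}"

definition triangles :: "'a set set \<Rightarrow> 'a set set set" where
  "triangles E = {{{a, b}, {a, c}, {b, c}} |a b c.
     a \<noteq> b \<and> a \<noteq> c \<and> b \<noteq> c \<and> {a, b} \<in> E \<and> {a, c} \<in> E \<and> {b, c} \<in> E}"

lemma triangles_mono: "E' \<subseteq> E \<Longrightarrow> triangles E' \<subseteq> triangles E"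
  unfolding triangles_def by (intro Collect_mono ex_mono) (simp add: subset_iff)

lemma connected_graph_has_neighbour:
  assumes G: "simple_graph V E" and conn: "connected_graph V E" and "E \<noteq> {}" and v: "v \<in> V"
  obtains w where "{v, w} \<in> E" "w \<noteq> v" "w \<in> V"
proof -
  obtain e where e: "e \<in> E" "e \<subseteq> V" "card e = 2"
    using assms by (auto simp: simple_graph_def)
  then obtain u where u: "u \<in> V" "u \<noteq> v"
    by (metis card_2_iff' subsetD)
  then have "(\<lambda>x y. {x, y} \<in> E)\<^sup>*\<^sup>* v u"
    using conn v by (auto simp: connected_graph_def)
  then obtain w where "{v, w} \<in> E"
    using u by (cases rule: converse_rtranclpE) auto
  then show thesis
    using that simple_graph_vertex[OF G] simple_graph_no_loop[OF G] by blast
qed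

lemma star_Un_subset_edges:
  assumes "T \<subseteq> triangles E" "\<tau> \<in> star E ` V \<union> T"
  shows "\<tau> \<subseteq> E"
  using assms by (auto simp: star_def triangles_def)

text \<open>Adding a simplicial vertex \<open>v\<close> with neighbours \<open>p\<close> and \<open>N\<close>: the simplices
  \<open>star p\<close> and \<open>star v\<close> are attached along cones, and then so are, for every \<open>b \<in> N\<close>, the
  triangle on \<open>v\<close>, \<open>p\<close>, \<open>b\<close> and the simplex \<open>star b\<close>.\<close>

lemma contractible_add_simplicial_vertex:
  assumes G: "simple_graph V E" and U: "finite U" "E \<subseteq> U"
    and v: "simplicial_vertex V E v"
    and E': "E' = {e \<in> E. e \<subseteq> V - {v}}"
    and p: "{v, p} \<in> E" "{p, q} \<in> E'"
    and T': "T' \<subseteq> triangles E'"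
    and contr: "contractible_space (realization U (faces (star E' ` (V - {v}) \<union> T')))"
  shows "\<exists>T\<subseteq>triangles E. contractible_space (realization U (faces (star E ` V \<union> T)))"
proof -
  define V' where "V' = V - {v}"
  define N where "N = {b. {v, b} \<in> E \<and> b \<noteq> p}"
  define F' where "F' = star E' ` V' \<union> T'"
  define F2 where "F2 = insert (star E v) (insert (star E p) F')"
  define tri where "tri b = {{p, v}, {v, b}, {p, b}}" for b
  \<comment> \<open>\<open>FM M\<close> is the stage at which the neighbours in \<open>M\<close>
    have received their triangles and their full stars.\<close>
  define FM where "FM M = F2 \<union> tri ` M \<union> star E ` M" for M
  have vV: "v \<in> V" using v by (simp add: simplicial_vertex_def)
  have pv: "p \<noteq> v" "p \<in> V'" "v \<noteq> p"
    using p simple_graph_vertex[OF G p(1)] simple_graph_no_loop[OF G] by (auto simp: V'_def)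
  have N: "b \<noteq> v" "v \<noteq> b" "b \<in> V'" "b \<noteq> p" "p \<noteq> b" "{v, b} \<in> E" "{p, b} \<in> E'" if "b \<in> N" for b
  proof -
    show b: "b \<noteq> v" "v \<noteq> b" "b \<in> V'" "b \<noteq> p" "p \<noteq> b" and "{v, b} \<in> E"
      using that simple_graph_vertex[OF G, of v b] simple_graph_no_loop[OF G] by (auto simp: V'_def N_def)
    moreover have "{p, b} \<in> E"
      using v p(1) that by (auto simp: simplicial_vertex_def N_def)
    ultimately show "{p, b} \<in> E'"
      using pv by (auto simp: E' V'_def)
  qed
  have E'E: "E' \<subseteq> E" by (auto simp: E')
  have edge: "\<exists>x y. e = {x, y} \<and> x \<noteq> y" if "e \<in> E" for e
    using that G by (auto simp: simple_graph_def card_2_iff)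
  have edge2: "e = {x, y}" if "e \<in> E" "x \<in> e" "y \<in> e" "x \<noteq> y" for e x y
    using edge[OF that(1)] that by auto
  have F'E: "\<tau> \<subseteq> E'" if "\<tau> \<in> F'" for \<tau>
    using that star_Un_subset_edges[OF T'] by (auto simp: F'_def)
  have vE': "{v, b} \<notin> E'" for b by (auto simp: E')
  \<comment> \<open>The star of \<open>p\<close> gains only \<open>{v, p}\<close>. What it shares
    with \<open>F'\<close> lies in the old star of \<open>p\<close>, which contains the apex
    \<open>{p, q}\<close>.\<close>
  have F1: "contractible_space (realization U (faces (insert (star E p) F')))"
  proof (rule contractible_realization_faces_insert[where w = "{p, q}"])
    show "{p, q} \<in> star E p" using p E'E by (auto simp: star_def)
    show "insert {p, q} (\<tau> \<inter> star E p) \<in> faces F'" if "\<tau> \<in> F'" for \<tau>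
    proof -
      have "insert {p, q} (\<tau> \<inter> star E p) \<subseteq> star E' p"
        using F'E[OF that] p by (auto simp: star_def)
      then show ?thesis using pv by (auto simp: faces_def F'_def)
    qed
  qed (use U pv contr in \<open>auto simp: star_def F'_def V'_def\<close>)
  have F2: "contractible_space (realization U (faces F2))"
    unfolding F2_def
  proof (rule contractible_realization_faces_insert[OF _ _ _ _ _ F1, where w = "{v, p}"])
    show "{v, p} \<in> star E v" using p by (auto simp: star_def)
    show "insert {v, p} (\<tau> \<inter> star E v) \<in> faces (insert (star E p) F')"
      if "\<tau> \<in> insert (star E p) F'" for \<tau>
    proof -
      \<comment> \<open>The only edge at \<open>v\<close> present so far is
        \<open>{v, p}\<close>.\<close>
      have "\<tau> \<inter> star E v \<subseteq> {{v, p}}"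
      proof
        fix e assume e: "e \<in> \<tau> \<inter> star E v"
        then have "e \<in> E" "v \<in> e" by (auto simp: star_def)
        then have "e \<notin> E'" by (auto simp: E')
        then have "p \<in> e" using e that F'E by (auto simp: star_def)
        then show "e \<in> {{v, p}}" using edge2[of e v p] \<open>e \<in> E\<close> \<open>v \<in> e\<close> pv by simp
      qed
      then show ?thesis using p by (auto simp: faces_def star_def)
    qed
  qed (use U in \<open>auto simp: star_def\<close>)
  have "contractible_space (realization U (faces (FM M)))" if "finite M" "M \<subseteq> N" for M
    using that
  proof (induction M rule: finite_induct)
    case empty
    then show ?case using F2 by (simp add: FM_def)
  next
    case (insert b M)
    then have b: "b \<in> N" "b \<notin> M" and M: "M \<subseteq> N" 
      and IH: "contractible_space (realization U (faces (FM M)))" by auto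
    note Nb = N[OF b(1)]
    \<comment> \<open>The new edge \<open>{v, b}\<close> has so far been used in no simplex other
      than the star of \<open>v\<close>; both attachments below hinge on this.\<close>
    have vb: "\<tau> = star E v" if \<tau>: "\<tau> \<in> FM M" and vb\<tau>: "{v, b} \<in> \<tau>" for \<tau>
    proof (rule ccontr)
      assume "\<tau> \<noteq> star E v"
      then consider "\<tau> \<in> F'" | "\<tau> = star E p" | c where "c \<in> M" "\<tau> = tri c" | c where "c \<in> M" "\<tau> = star E c"
        using \<tau> unfolding FM_def F2_def by blast
      then show False
      proof cases
        case 1
        then show False using F'E vE' vb\<tau> by blast
      next
        case 2
        then show False using vb\<tau> Nb pv by (auto simp: star_def)
      next
        case 3
        then have "c \<noteq> b" "c \<noteq> v" "c \<noteq> p" using b M N[of c] by auto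
        then show False using vb\<tau> 3 Nb pv by (auto simp: tri_def doubleton_eq_iff)
      next
        case 4
        then have "c \<noteq> b" "c \<noteq> v" using b M N[of c] by auto
        then show False using vb\<tau> 4 by (auto simp: star_def)
      qed
    qed
    have triE: "tri b \<subseteq> E" using Nb p E'E by (auto simp: tri_def insert_commute)
    \<comment> \<open>The earlier complex meets the triangle in its two sides through
      \<open>{p, v}\<close>: the one with \<open>{v, b}\<close> lies in the star of
      \<open>v\<close>, the one with \<open>{p, b}\<close> in the star of \<open>p\<close>.\<close>
    have 1: "contractible_space (realization U (faces (insert (tri b) (FM M))))"
    proof (rule contractible_realization_faces_insert[OF _ _ _ _ _ IH, where w = "{p, v}"])
      show "insert {p, v} (\<tau> \<inter> tri b) \<in> faces (FM M)" if "\<tau> \<in> FM M" for \<tau>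
      proof (cases "{v, b} \<in> \<tau>")
        case True
        then have "\<tau> = star E v" using vb that by blast
        then have "insert {p, v} (\<tau> \<inter> tri b) \<subseteq> star E v"
          using p by (auto simp: star_def insert_commute)
        then show ?thesis by (auto simp: faces_def FM_def F2_def)
      next
        case False
        then have "insert {p, v} (\<tau> \<inter> tri b) \<subseteq> star E p"
          using Nb p E'E by (auto simp: star_def tri_def insert_commute)
        then show ?thesis by (auto simp: faces_def FM_def F2_def)
      qed
    qed (use U triE in \<open>auto simp: FM_def F2_def tri_def\<close>)
    \<comment> \<open>Simplices containing \<open>{v, b}\<close> meet the star of \<open>b\<close>
      within the side \<open>{{v, b}, {p, b}}\<close> of the new triangle, all others within its old
      star. Both contain the apex \<open>{p, b}\<close>.\<close>
    have "contractible_space (realization U (faces (insert (star E b) (insert (tri b) (FM M)))))"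
    proof (rule contractible_realization_faces_insert[OF _ _ _ _ _ 1, where w = "{p, b}"])
      show "{p, b} \<in> star E b" using Nb E'E by (auto simp: star_def)
      show "insert {p, b} (\<tau> \<inter> star E b) \<in> faces (insert (tri b) (FM M))"
        if \<tau>: "\<tau> \<in> insert (tri b) (FM M)" for \<tau>
      proof (cases "{v, b} \<in> \<tau>")
        case True
        then have "\<tau> = tri b \<or> \<tau> = star E v" using vb \<tau> by blast
        moreover have "star E v \<inter> star E b \<subseteq> {{v, b}}"
          using edge2 Nb(2) unfolding star_def by blast
        ultimately have "insert {p, b} (\<tau> \<inter> star E b) \<subseteq> tri b"
          by (auto simp: tri_def)
        then show ?thesis by (auto simp: faces_def)
      next
        case False
        have "insert {p, b} (\<tau> \<inter> star E b) \<subseteq> star E' b"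
        proof -
          have "e \<in> star E' b" if "e \<in> \<tau>" "e \<in> star E b" for e
          proof -
            have e: "e \<in> E" "b \<in> e" using that by (auto simp: star_def)
            then have "v \<notin> e" using edge2[of e v b] False that Nb by auto
            moreover have "e \<subseteq> V" using e G by (auto simp: simple_graph_def)
            ultimately show ?thesis using e by (auto simp: star_def E')
          qed
          then show ?thesis using Nb by (auto simp: star_def)
        qed
        then show ?thesis using Nb by (auto simp: faces_def FM_def F2_def F'_def)
      qed
    qed (use U in \<open>auto simp: star_def\<close>)
    moreover have "insert (star E b) (insert (tri b) (FM M)) = FM (insert b M)"
      by (auto simp: FM_def)
    ultimately show ?case by simp
  qed
  moreover have "finite N"
  proof (rule finite_subset)
    show "N \<subseteq> V" using simple_graph_vertex[OF G, of v] by (auto simp: N_def)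
    show "finite V" using G by (simp add: simple_graph_def)
  qed
  ultimately have contrN: "contractible_space (realization U (faces (FM N)))" by simp
  let ?T = "T' \<union> tri ` N"
  have "?T \<subseteq> triangles E"
  proof -
    have "T' \<subseteq> triangles E" using T' triangles_mono[OF E'E] by blast
    moreover have "tri b \<in> triangles E" if "b \<in> N" for b
    proof -
      have "tri b = {{p, v}, {p, b}, {v, b}}" by (auto simp: tri_def)
      then show ?thesis
        unfolding triangles_def mem_Collect_eq using N[OF that] pv p E'E
        by (intro exI[of _ p] exI[of _ v] exI[of _ b]) (auto simp: insert_commute)
    qed
    ultimately show ?thesis by auto
  qed
  \<comment> \<open>The old stars left in \<open>FM N\<close> are faces of the new ones; for a
    vertex other than \<open>v\<close> and not adjacent to it, the old and the new star
    coincide.\<close>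
  moreover have "faces (FM N) = faces (star E ` V \<union> ?T)"
  proof -
    have FMsub: "FM N \<subseteq> star E' ` V' \<union> star E ` V \<union> ?T"
      using vV pv(2) N(3) by (auto simp: FM_def F2_def F'_def V'_def)
    have "\<tau> \<in> faces (star E ` V \<union> ?T)" if \<tau>N: "\<tau> \<in> FM N" for \<tau>
    proof -
      have sub: "star E' x \<subseteq> star E x" for x using E'E by (auto simp: star_def)
      consider x where "x \<in> V'" "\<tau> = star E' x" | x where "x \<in> V" "\<tau> = star E x" | "\<tau> \<in> ?T"
        using FMsub \<tau>N by blast
      then show ?thesis
      proof cases
        case 1
        then show ?thesis using sub by (intro facesI[of "star E x"]) (auto simp: V'_def)
      qed (auto simp: faces_def)
    qed
    moreover have "\<tau> \<in> faces (FM N)" if "\<tau> \<in> star E ` V \<union> ?T" for \<tau>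
    proof -
      have "star E x \<subseteq> star E' x" if x: "x \<in> V" "x \<noteq> v" "x \<noteq> p" "x \<notin> N" for x
      proof
        fix e assume "e \<in> star E x"
        then have e: "e \<in> E" "x \<in> e" by (auto simp: star_def)
        have "v \<notin> e"
        proof
          assume "v \<in> e"
          then have "{v, x} \<in> E" using edge2[of e v x] e x by auto
          then show False using x by (simp add: N_def)
        qed
        moreover have "e \<subseteq> V" using e G by (auto simp: simple_graph_def)
        ultimately show "e \<in> star E' x" using e by (auto simp: star_def E')
      qed
      note sub = this
      have "star E x \<in> faces (FM N)" if "x \<in> V" for x
      proof (cases "x = v \<or> x = p \<or> x \<in> N")
        case True
        then have "star E x \<in> FM N" by (auto simp: FM_def F2_def)
        then show ?thesis by (rule facesI) simp
      next
        case False
        then have "star E' x \<in> FM N" using that by (auto simp: FM_def F2_def F'_def V'_def)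
        then show ?thesis using sub[OF that] False by (blast intro: facesI)
      qed
      moreover have "\<tau> \<in> FM N" if "\<tau> \<in> ?T" using that by (auto simp: FM_def F2_def F'_def)
      then have "\<tau> \<in> faces (FM N)" if "\<tau> \<in> ?T" using that facesI by blast
      ultimately show ?thesis using that by blast
    qed
    ultimately show ?thesis
      by (intro equalityI faces_subset) auto
  qed
  ultimately show ?thesis
    using contrN by (intro exI[of _ ?T]) auto
qed

text \<open>The graph is rebuilt along a perfect elimination order. The ambient \<open>U\<close>
  stays fixed while \<open>V\<close> and \<open>E\<close> shrink in the induction, so that all
  stages live in one space of coordinates.\<close>

lemma ex_contractible_subcomplex:
  assumes "simple_graph V E" "connected_graph V E" "chordal V E" "E \<noteq> {}" "finite U" "E \<subseteq> U"
  shows "\<exists>T\<subseteq>triangles E. contractible_space (realization U (faces (star E ` V \<union> T)))"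
  using assms
proof (induction "card V" arbitrary: V E rule: less_induct)
  case less
  note G = \<open>simple_graph V E\<close>
  have "V \<noteq> {}" using less.prems(2) by (simp add: connected_graph_def)
  then obtain v where v: "simplicial_vertex V E v"
    using chordal_has_simplicial_vertex less.prems by blast
  then have vV: "v \<in> V" by (simp add: simplicial_vertex_def)
  let ?V' = "V - {v}"
  define E' where "E' = {e \<in> E. e \<subseteq> ?V'}"
  show ?case
  proof (cases "E' = {}")
    \<comment> \<open>No edge avoids \<open>v\<close>, so every star is a face of the star of
      \<open>v\<close>, and the complex is a full simplex.\<close>
    case True
    have EV: "e \<subseteq> V" if "e \<in> E" for e using that G by (auto simp: simple_graph_def)
    have "v \<in> e" if "e \<in> E" for e
      using True EV[OF that] that by (auto simp: E'_def)
    then have "star E v = E" by (auto simp: star_def)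
    then have "faces (star E ` V \<union> {}) = Pow E"
      using vV by (auto simp: faces_def star_def)
    moreover obtain e where "e \<in> E" using \<open>E \<noteq> {}\<close> by blast
    ultimately have "contractible_space (realization U (faces (star E ` V \<union> {})))"
      using contractible_realization_Pow[of U e E] less.prems by simp
    then show ?thesis by (intro exI[of _ "{}"]) simp
  next
    case False
    have G': "simple_graph ?V' E'" "chordal ?V' E'"
      unfolding E'_def
      using simple_graph_induced[OF G, of ?V'] chordal_induced[OF \<open>chordal V E\<close>, of ?V'] by auto
    obtain p where p: "{v, p} \<in> E" "p \<in> ?V'"
      using connected_graph_has_neighbour[OF G \<open>connected_graph V E\<close> \<open>E \<noteq> {}\<close> vV] by blast
    then have conn: "connected_graph ?V' E'"
      unfolding E'_def using connected_graph_remove_simplicial[OF G \<open>connected_graph V E\<close> v] by blast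
    \<comment> \<open>The rest is connected and still has an edge, so \<open>p\<close> has a
      neighbour there; the edge to it is the apex for the star of \<open>p\<close>.\<close>
    obtain q where q: "{p, q} \<in> E'"
      using connected_graph_has_neighbour[OF G'(1) conn False p(2)] by blast
    have "card ?V' < card V"
      using G vV by (intro psubset_card_mono) (auto simp: simple_graph_def)
    moreover have "E' \<subseteq> U" using less.prems by (auto simp: E'_def)
    ultimately obtain T' where "T' \<subseteq> triangles E'"
      "contractible_space (realization U (faces (star E' ` ?V' \<union> T')))"
      using less.hyps[OF _ G'(1) conn G'(2) False \<open>finite U\<close>] by blast
    then show ?thesis
      using contractible_add_simplicial_vertex[OF G \<open>finite U\<close> \<open>E \<subseteq> U\<close> v E'_def p(1) q] by blast
  qed
qed

text \<open>Pairwise meeting edges share a vertex or are sides of one triangle. If no vertex is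
  common, take an edge \<open>{a, b}\<close>; an edge missing \<open>a\<close> is some
  \<open>{b, c}\<close>, an edge missing \<open>b\<close> must then be \<open>{a, c}\<close>, and
  any edge meeting all three contains two of \<open>a\<close>, \<open>b\<close>,
  \<open>c\<close>.\<close>

lemma line_clique_complex_eq_faces:
  assumes G: "simple_graph V E" and "V \<noteq> {}"
  shows "line_clique_complex E = faces (star E ` V \<union> triangles E)"
proof -
  have finE: "finite E"
    using G by (auto simp: simple_graph_def intro: finite_subset[of _ "Pow V"])
  have card2: "card e = 2" and eV: "e \<subseteq> V" if "e \<in> E" for e
    using G that by (auto simp: simple_graph_def)
  have adj: "{e, f} \<in> line_graph_edges E \<longleftrightarrow> card (e \<inter> f) = 1" if "e \<in> E" "f \<in> E" for e f
    using that by (auto simp: line_graph_edges_def doubleton_eq_iff Int_commute) 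
  have mem: "S \<in> line_clique_complex E \<longleftrightarrow> S \<subseteq> E \<and> (\<forall>e\<in>S. \<forall>f\<in>S. e \<noteq> f \<longrightarrow> card (e \<inter> f) = 1)" for S
  proof -
    have "{e, f} \<in> line_graph_edges E \<longleftrightarrow> card (e \<inter> f) = 1" if "S \<subseteq> E" "e \<in> S" "f \<in> S" for e f
      using adj that by (simp add: subset_iff)
    moreover have "finite S" if "S \<subseteq> E" using that finE finite_subset by blast
    ultimately show ?thesis
      unfolding line_clique_complex_def clique_complex_def mem_Collect_eq by metis
  qed
  have edge2: "e = {x, y}" if "e \<in> E" "x \<in> e" "y \<in> e" "x \<noteq> y" for e x y
    using card2[OF that(1)] that by (auto simp: card_2_iff)
  have dn: "S' \<in> line_clique_complex E" if "S \<in> line_clique_complex E" "S' \<subseteq> S" for S S'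
    using that unfolding mem by (meson subset_iff)
  have "star E v \<in> line_clique_complex E" for v
    unfolding mem
  proof (intro conjI ballI impI)
    fix e f assume ef: "e \<in> star E v" "f \<in> star E v" "e \<noteq> f"
    then have "e \<in> E" "v \<in> e" "f \<in> E" "v \<in> f" by (auto simp: star_def)
    then have "x = v" if "x \<in> e" "x \<in> f" for x
      using edge2[of e v x] edge2[of f v x] that ef(3) by blast
    then have "e \<inter> f = {v}"
      using \<open>v \<in> e\<close> \<open>v \<in> f\<close> by blast
    then show "card (e \<inter> f) = 1" by simp
  qed (auto simp: star_def)
  moreover have "t \<in> line_clique_complex E" if t: "t \<in> triangles E" for t
  proof -
    obtain a b c where abc: "a \<noteq> b" "a \<noteq> c" "b \<noteq> c" "{a, b} \<in> E" "{a, c} \<in> E" "{b, c} \<in> E"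
      and "t = {{a, b}, {a, c}, {b, c}}"
      using t by (auto simp: triangles_def)
    moreover have "{a, b} \<inter> {a, c} = {a}" "{a, b} \<inter> {b, c} = {b}" "{a, c} \<inter> {b, c} = {c}"
      using abc by auto
    ultimately show ?thesis
      unfolding mem by (simp add: Int_commute)
  qed
  ultimately have "faces (star E ` V \<union> triangles E) \<subseteq> line_clique_complex E"
    unfolding faces_def using dn by blast
  moreover have "S \<in> faces (star E ` V \<union> triangles E)" if S: "S \<in> line_clique_complex E" for S
  proof (cases "\<exists>v\<in>V. S \<subseteq> star E v")
    case True
    then show ?thesis by (auto simp: faces_def)
  next
    case False
    have SE: "S \<subseteq> E" and meet: "\<And>e f. e \<in> S \<Longrightarrow> f \<in> S \<Longrightarrow> e \<noteq> f \<Longrightarrow> card (e \<inter> f) = 1"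
      using S unfolding mem by auto
    have int: "e \<inter> f \<noteq> {}" if "e \<in> S" "f \<in> S" for e f
      using meet[OF that] that SE card2[of e] by (cases "e = f") auto
    have miss: "\<exists>f\<in>S. x \<notin> f" if "x \<in> V" for x
      using False that SE unfolding star_def by blast
    obtain e where e: "e \<in> S" using miss \<open>V \<noteq> {}\<close> by blast
    then have "card e = 2" using card2 SE by blast
    then obtain a b where ab: "e = {a, b}" "a \<noteq> b" by (auto simp: card_2_iff)
    have abV: "a \<in> V" "b \<in> V" using eV e ab SE by auto
    obtain f where f: "f \<in> S" "a \<notin> f" using miss abV by blast
    then have bf: "b \<in> f" using int[OF e f(1)] ab by auto
    obtain c where c: "f = {b, c}" "c \<noteq> b" 
      using card2[of f] f SE bf by (auto simp: card_2_iff)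
    have ca: "c \<noteq> a" using c f by auto
    obtain g where g: "g \<in> S" "b \<notin> g" using miss abV by blast
    then have ag: "a \<in> g" "c \<in> g" using int[OF e g(1)] int[OF f(1) g(1)] ab c by auto
    then have gac: "g = {a, c}" using edge2[of g a c] g SE ca by auto
    have "h \<in> {{a, b}, {a, c}, {b, c}}" if h: "h \<in> S" for h
    proof -
      have hE: "h \<in> E" using h SE by blast
      have "a \<in> h \<or> b \<in> h" "b \<in> h \<or> c \<in> h" "a \<in> h \<or> c \<in> h"
        using int[OF e h] int[OF f(1) h] int[OF g(1) h] ab c gac by auto
      then consider "a \<in> h" "b \<in> h" | "b \<in> h" "c \<in> h" | "a \<in> h" "c \<in> h" by argo
      then show ?thesis
        using edge2[OF hE, of a b] edge2[OF hE, of b c] edge2[OF hE, of a c] ab(2) c(2) ca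
        by cases simp_all
    qed
    moreover have "{{a, b}, {a, c}, {b, c}} \<in> triangles E"
      using ab c gac ca e f g SE unfolding triangles_def by auto
    ultimately show ?thesis unfolding faces_def by blast
  qed
  ultimately show ?thesis by blast
qed

section \<open>Collapsing a contractible subspace\<close>

lemma homotopic_withI:
  assumes "continuous_map (prod_topology (top_of_set {0..1::real}) X) Y h"
    and "\<And>x. x \<in> topspace X \<Longrightarrow> h (0, x) = p x" "\<And>x. x \<in> topspace X \<Longrightarrow> h (1, x) = q x"
  shows "homotopic_with (\<lambda>x. True) X Y p q"
proof -
  have "\<exists>h. continuous_map (prod_topology (top_of_set {0..1::real}) X) Y h \<and>
    (\<forall>x\<in>topspace X. h (0, x) = p x) \<and> (\<forall>x\<in>topspace X. h (1, x) = q x) \<and>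
    (\<forall>t\<in>{0..1}. True)"
    using assms by blast
  then show ?thesis
    by (subst homotopic_with) simp_all
qed

text \<open>The end of the deformation is constant on \<open>A\<close>, hence factors through
  \<open>q\<close>; the factor \<open>g\<close> is the homotopy inverse. The deformation itself
  preserves \<open>A\<close>, hence descends to a homotopy on \<open>W\<close> from the identity to
  \<open>q \<circ> g\<close>.\<close>

lemma homotopy_equivalent_space_quotient:
  assumes q: "quotient_map X W q" and A: "A \<subseteq> topspace X"
    and H: "continuous_map (prod_topology (top_of_set {0..1::real}) X) X H"
    and H0: "\<And>x. x \<in> topspace X \<Longrightarrow> H (0, x) = x"
    and HA: "\<And>t x. \<lbrakk>0 \<le> t; t \<le> 1; x \<in> A\<rbrakk> \<Longrightarrow> H (t, x) \<in> A"
    and H1: "\<And>x. x \<in> A \<Longrightarrow> H (1, x) = a"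
    and qA: "\<And>x y. \<lbrakk>x \<in> A; y \<in> A\<rbrakk> \<Longrightarrow> q x = q y"
    and inj: "\<And>x y. \<lbrakk>x \<in> topspace X; y \<in> topspace X; q x = q y\<rbrakk> \<Longrightarrow> x = y \<or> x \<in> A \<and> y \<in> A"
  shows "X homotopy_equivalent_space W"
proof -
  let ?I = "top_of_set {0..1::real}"
  have cq: "continuous_map X W q" using q by (rule quotient_imp_continuous_map)
  have surj: "q ` topspace X = topspace W" using q by (rule quotient_imp_surjective_map)
  have HX: "H (t, x) \<in> topspace X" if "0 \<le> t" "t \<le> 1" "x \<in> topspace X" for t x
    using H that by (auto simp: continuous_map_def)
  have cH1: "continuous_map X X (\<lambda>x. H (1, x))"
  proof -
    have "continuous_map X (prod_topology ?I X) (\<lambda>x. (1, x))"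
      by (auto simp: continuous_map_pairwise o_def)
    from continuous_map_compose[OF this H] show ?thesis by (simp add: o_def)
  qed
  obtain g where g: "continuous_map W X g" "\<And>x. x \<in> topspace X \<Longrightarrow> g (q x) = H (1, x)"
    using quotient_map_lift_exists[OF q cH1] inj H1 by metis
  have "homotopic_with (\<lambda>x. True) X X id (g \<circ> q)"
    by (rule homotopic_withI[OF H]) (simp_all add: H0 g(2))
  moreover have "homotopic_with (\<lambda>x. True) W W id (q \<circ> g)"
  proof -
    \<comment> \<open>The product of a quotient map with a locally compact Hausdorff space is again
      a quotient map, so a homotopy on \<open>W\<close> may be defined on \<open>X\<close>.\<close>
    have "compact_space ?I" "Hausdorff_space ?I"
      by (simp_all add: compact_space_subtopology Hausdorff_space_subtopology)
    then have Q: "quotient_map (prod_topology ?I X) (prod_topology ?I W) (\<lambda>(t, x). (t, q x))"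
      by (intro quotient_map_prod_right q compact_imp_locally_compact_space) auto
    have "(q \<circ> H) p = (q \<circ> H) p'"
      if pp: "p \<in> topspace (prod_topology ?I X)" "p' \<in> topspace (prod_topology ?I X)"
        "(\<lambda>(t, x). (t, q x)) p = (\<lambda>(t, x). (t, q x)) p'" for p p'
    proof -
      obtain t x y where p: "p = (t, x)" "p' = (t, y)" and t: "0 \<le> t" "t \<le> 1"
        and xy: "x \<in> topspace X" "y \<in> topspace X" "q x = q y"
        using pp by auto
      then consider "x = y" | "x \<in> A" "y \<in> A" using inj by blast
      then show ?thesis
      proof cases
        case 2
        then show ?thesis using qA[OF HA[OF t 2(1)] HA[OF t 2(2)]] by (simp add: p)
      qed (simp add: p)
    qed
    then obtain k where k: "continuous_map (prod_topology ?I W) W k"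
        "\<And>p. p \<in> topspace (prod_topology ?I X) \<Longrightarrow> k ((\<lambda>(t, x). (t, q x)) p) = (q \<circ> H) p"
      using quotient_map_lift_exists[OF Q continuous_map_compose[OF H cq]] by metis
    have k': "k (t, q x) = q (H (t, x))" if "0 \<le> t" "t \<le> 1" "x \<in> topspace X" for t x
      using k(2)[of "(t, x)"] that by auto
    have "k (0, w) = w" "k (1, w) = (q \<circ> g) w" if w: "w \<in> topspace W" for w
    proof -
      obtain x where "x \<in> topspace X" "w = q x" using surj w by blast
      then show "k (0, w) = w" "k (1, w) = (q \<circ> g) w"
        using k' H0 g by auto
    qed
    then show ?thesis
      by (intro homotopic_withI[OF k(1)]) simp_all
  qed
  ultimately show ?thesis
    unfolding homotopy_equivalent_space_def using cq g(1)
    by (intro exI[of _ q] exI[of _ g]) (simp add: homotopic_with_sym)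
qed

section \<open>The triangle modulo its boundary is a sphere\<close>

text \<open>With \<open>d\<close> the smallest barycentric coordinate, the interior of the triangle is mapped
  homeomorphically onto the plane by \<open>((x - z) / d, (y - z) / d)\<close>, and this is followed by the
  inverse of the stereographic projection from the base point.\<close>

definition triangle_to_sphere :: "real \<Rightarrow> real \<Rightarrow> real \<Rightarrow> nat \<Rightarrow> real" where
  "triangle_to_sphere x y z = (let d = min x (min y z); u = x - z; v = y - z; n = u\<^sup>2 + v\<^sup>2 + d\<^sup>2
     in (\<lambda>j. if j = 0 then (u\<^sup>2 + v\<^sup>2 - d\<^sup>2) / n else if j = 1 then 2 * d * u / n
         else if j = 2 then 2 * d * v / n else 0))"

text \<open>In \<open>triangle_to_sphere\<close> the inverse stereographic projection is expanded by
  \<open>d\<^sup>2\<close>, so that it makes sense on the boundary too, where \<open>d = 0\<close>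
  and the value is the base point. The common denominator could vanish only if all coordinates were
  equal and zero.\<close>

lemma triangle_to_sphere_denominator_pos:
  assumes "x + y + z = 1"
  shows "(x - z)\<^sup>2 + (y - z)\<^sup>2 + (min x (min y z))\<^sup>2 > (0::real)"
proof (rule ccontr)
  assume "\<not> ?thesis"
  then have "(x - z)\<^sup>2 + (y - z)\<^sup>2 + (min x (min y z))\<^sup>2 = 0"
    by (meson add_nonneg_nonneg antisym not_le zero_le_power2)
  then have "x = z" "y = z" "min x (min y z) = 0"
    by (auto simp: add_nonneg_eq_0_iff)
  then show False using assms by simp
qed

lemma topspace_nsphere_2:
  "y \<in> topspace (nsphere 2) \<longleftrightarrow> (y 0)\<^sup>2 + (y 1)\<^sup>2 + (y 2)\<^sup>2 = 1 \<and> (\<forall>i>2. y i = 0)"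
  by (simp add: nsphere numeral_2_eq_2 add.assoc)

lemma triangle_to_sphere_in_sphere:
  assumes "x + y + z = 1"
  shows "triangle_to_sphere x y z \<in> topspace (nsphere 2)"
proof -
  define d u v n where "d = min x (min y z)" and "u = x - z" and "v = y - z" and "n = u\<^sup>2 + v\<^sup>2 + d\<^sup>2"
  have n: "n > 0"
    using triangle_to_sphere_denominator_pos[OF assms] by (simp add: n_def d_def u_def v_def)
  have "(u\<^sup>2 + v\<^sup>2 - d\<^sup>2)\<^sup>2 + (2 * d * u)\<^sup>2 + (2 * d * v)\<^sup>2 = n\<^sup>2"
    unfolding n_def by (simp add: power2_eq_square algebra_simps)
  then have "((u\<^sup>2 + v\<^sup>2 - d\<^sup>2) / n)\<^sup>2 + (2 * d * u / n)\<^sup>2 + (2 * d * v / n)\<^sup>2 = 1"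
    using n by (simp add: power_divide flip: add_divide_distrib)
  then show ?thesis
    by (simp add: topspace_nsphere_2 triangle_to_sphere_def Let_def flip: d_def u_def v_def n_def)
qed

text \<open>The left side is the divisor in stereographic projection from the base point; in this
  form it visibly vanishes exactly when the smallest coordinate does.\<close>

lemma one_minus_triangle_to_sphere_0:
  assumes "x + y + z = 1"
  shows "1 - triangle_to_sphere x y z 0 =
    2 * (min x (min y z))\<^sup>2 / ((x - z)\<^sup>2 + (y - z)\<^sup>2 + (min x (min y z))\<^sup>2)"
  using triangle_to_sphere_denominator_pos[OF assms]
  by (simp add: triangle_to_sphere_def Let_def field_simps)

lemma triangle_to_sphere_eq_base_iff:
  assumes "x + y + z = 1"
  shows "triangle_to_sphere x y z = sphere_base \<longleftrightarrow> min x (min y z) = 0"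
proof
  assume "triangle_to_sphere x y z = sphere_base"
  then have "1 - triangle_to_sphere x y z 0 = 0" by (simp add: sphere_base_def)
  then show "min x (min y z) = 0"
    using triangle_to_sphere_denominator_pos[OF assms]
    unfolding one_minus_triangle_to_sphere_0[OF assms] by auto
next
  assume "min x (min y z) = 0"
  then show "triangle_to_sphere x y z = sphere_base"
    using triangle_to_sphere_denominator_pos[OF assms]
    by (auto simp: triangle_to_sphere_def Let_def sphere_base_def fun_eq_iff)
qed

text \<open>After subtracting \<open>z\<close>, the minimum reads
  \<open>d - z = d * min P (min Q 0)\<close>. This gives \<open>z\<close>, and total mass 1 then
  fixes \<open>d\<close>, so the plane point determines all three coordinates.\<close>

lemma barycentric_from_plane:
  fixes x y z d P Q :: real
  assumes "x + y + z = 1" "d = min x (min y z)" "x - z = d * P" "y - z = d * Q" "d > 0"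
  shows "z = d * (1 - min P (min Q 0))" and "d * (3 - 3 * min P (min Q 0) + P + Q) = 1"
proof -
  have "d = min (z + d * P) (min (z + d * Q) z)"
    using assms by (smt (verit))
  also have "\<dots> = z + min (d * P) (min (d * Q) (d * 0))" by (simp add: min_def)
  also have "\<dots> = z + d * min P (min Q 0)"
    using assms(5) by (simp add: min_mult_distrib_left)
  finally show z: "z = d * (1 - min P (min Q 0))" by (simp add: algebra_simps)
  have "x + y + z = d * P + d * Q + 3 * z" using assms by linarith
  then show "d * (3 - 3 * min P (min Q 0) + P + Q) = 1"
    using z assms(1) by (simp add: algebra_simps)
qed

lemma triangle_to_sphere_inj:
  assumes s: "x + y + z = 1" "x' + y' + z' = 1"
    and pos: "min x (min y z) > 0" "min x' (min y' z') > 0"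
    and eq: "triangle_to_sphere x y z = triangle_to_sphere x' y' z'"
  shows "x = x' \<and> y = y' \<and> z = z'"
proof -
  \<comment> \<open>The left sides are stereographic coordinates, so points with equal images have
    the same \<open>P\<close> and \<open>Q\<close>.\<close>
  have coord: "triangle_to_sphere x y z 1 / (1 - triangle_to_sphere x y z 0) = (x - z) / min x (min y z)"
    "triangle_to_sphere x y z 2 / (1 - triangle_to_sphere x y z 0) = (y - z) / min x (min y z)"
    if "x + y + z = 1" "min x (min y z) > 0" for x y z
    unfolding one_minus_triangle_to_sphere_0[OF that(1)]
    using triangle_to_sphere_denominator_pos[OF that(1)] that(2)
    by (simp_all add: triangle_to_sphere_def Let_def power2_eq_square)
  define d d' where "d = min x (min y z)" and "d' = min x' (min y' z')"
  define P Q where "P = (x - z) / d" and "Q = (y - z) / d"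
  have P': "P = (x' - z') / d'" and Q': "Q = (y' - z') / d'"
    using coord[OF s(1) pos(1)] coord[OF s(2) pos(2)] eq by (simp_all add: P_def Q_def d_def d'_def)
  have d: "d > 0" "d' > 0" using pos by (simp_all add: d_def d'_def)
  have xy: "x - z = d * P" "y - z = d * Q" "x' - z' = d' * P" "y' - z' = d' * Q"
    using d by (simp add: P_def, simp add: Q_def, simp add: P', simp add: Q')
  note b = barycentric_from_plane[OF s(1) d_def xy(1,2) d(1)]
    barycentric_from_plane[OF s(2) d'_def xy(3,4) d(2)]
  have "d = d'"
    using b(2,4) by (metis mult_cancel_right mult_zero_right zero_neq_one)
  then show ?thesis using b(1,3) xy by simp
qed

lemma triangle_to_sphere_surj:
  assumes "w \<in> topspace (nsphere 2)"
  shows "\<exists>x y z. 0 \<le> x \<and> 0 \<le> y \<and> 0 \<le> z \<and> x + y + z = 1 \<and> triangle_to_sphere x y z = w"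
proof (cases "w 0 = 1")
  case True
  have w: "(w 0)\<^sup>2 + (w 1)\<^sup>2 + (w 2)\<^sup>2 = 1" "\<And>i. i > 2 \<Longrightarrow> w i = 0"
    using assms by (auto simp: topspace_nsphere_2)
  then have "w 1 = 0" "w 2 = 0"
    using True by (auto simp: add_nonneg_eq_0_iff)
  have "w i = sphere_base i" for i
  proof -
    consider "i = 0" | "i = 1" | "i = 2" | "i > 2" by linarith
    then show ?thesis
      by cases (use True \<open>w 1 = 0\<close> \<open>w 2 = 0\<close> w(2) in \<open>auto simp: sphere_base_def\<close>)
  qed
  then have "w = sphere_base" by blast
  \<comment> \<open>Every boundary point goes to the base point; a vertex serves as
    preimage.\<close>
  moreover have "triangle_to_sphere 1 0 0 = sphere_base"
    by (subst triangle_to_sphere_eq_base_iff) auto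
  ultimately show ?thesis
    by (intro exI[of _ 1] exI[of _ 0]) auto
next
  case False
  have w: "(w 0)\<^sup>2 + (w 1)\<^sup>2 + (w 2)\<^sup>2 = 1" "\<And>i. i > 2 \<Longrightarrow> w i = 0"
    using assms by (auto simp: topspace_nsphere_2)
  \<comment> \<open>\<open>P\<close> and \<open>Q\<close> are the stereographic coordinates of
    \<open>w\<close>; the choices of \<open>d\<close> and \<open>z\<close> are the formulas of
    \<open>barycentric_from_plane\<close>.\<close>
  define P Q m where "P = w 1 / (1 - w 0)" and "Q = w 2 / (1 - w 0)" and "m = min P (min Q 0)"
  define d where "d = 1 / (3 - 3 * m + P + Q)"
  define z where "z = d * (1 - m)"
  define x where "x = z + d * P"
  define y where "y = z + d * Q"
  have m: "m \<le> P" "m \<le> Q" "m \<le> 0" by (auto simp: m_def)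
  then have k: "3 - 3 * m + P + Q > 0" by linarith
  then have d: "d > 0" by (simp add: d_def)
  have xeq: "x = d * (1 - m + P)" and yeq: "y = d * (1 - m + Q)"
    by (simp_all add: x_def y_def z_def algebra_simps)
  have pos: "0 \<le> x" "0 \<le> y" "0 \<le> z"
    using m d by (auto simp: xeq yeq z_def intro!: mult_nonneg_nonneg)
  have "x + y + z = d * (3 - 3 * m + P + Q)"
    by (simp add: xeq yeq z_def algebra_simps)
  then have sum1: "x + y + z = 1" using k by (simp add: d_def)
  have "min x (min y z) = d * min (1 - m + P) (min (1 - m + Q) (1 - m))"
    using d by (simp add: xeq yeq z_def min_mult_distrib_left)
  \<comment> \<open>By the choice of \<open>m\<close>, the smallest of \<open>P - m\<close>,
    \<open>Q - m\<close> and \<open>- m\<close> is 0, so \<open>d\<close> is indeed the smallest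
    coordinate.\<close>
  also have "min (1 - m + P) (min (1 - m + Q) (1 - m)) = 1" by (auto simp: m_def min_def)
  finally have dmin: "min x (min y z) = d" by simp
  have w0: "1 - w 0 \<noteq> 0" using False by simp
  have PQ: "P\<^sup>2 + Q\<^sup>2 = (1 + w 0) / (1 - w 0)"
  proof -
    have "P\<^sup>2 + Q\<^sup>2 = ((w 1)\<^sup>2 + (w 2)\<^sup>2) / (1 - w 0)\<^sup>2"
      by (simp add: P_def Q_def power_divide add_divide_distrib)
    also have "(w 1)\<^sup>2 + (w 2)\<^sup>2 = (1 + w 0) * (1 - w 0)"
      using w(1) by (simp add: power2_eq_square algebra_simps)
    finally show ?thesis using w0 by (simp add: power2_eq_square)
  qed
  have n1: "P\<^sup>2 + Q\<^sup>2 + 1 = 2 / (1 - w 0)"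
    unfolding PQ using w0 by (simp add: field_simps)
  have n2: "P\<^sup>2 + Q\<^sup>2 - 1 = 2 * w 0 / (1 - w 0)"
    unfolding PQ using w0 by (simp add: field_simps)
  have xz: "x - z = d * P" "y - z = d * Q" by (simp_all add: x_def y_def)
  have n: "(d * P)\<^sup>2 + (d * Q)\<^sup>2 + d\<^sup>2 = d\<^sup>2 * (P\<^sup>2 + Q\<^sup>2 + 1)"
    by (simp add: power2_eq_square algebra_simps)
  have n': "(d * P)\<^sup>2 + (d * Q)\<^sup>2 - d\<^sup>2 = d\<^sup>2 * (P\<^sup>2 + Q\<^sup>2 - 1)"
    by (simp add: power2_eq_square algebra_simps)
  have ph: "2 * d * (d * R) = d\<^sup>2 * (2 * R)" for R
    by (simp add: power2_eq_square)
  have "triangle_to_sphere x y z i = w i" for i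
  proof -
    consider "i = 0" | "i = 1" | "i = 2" | "i > 2" by linarith
    then show ?thesis
    proof cases
      case 1
      then show ?thesis
        using d w0 by (simp add: triangle_to_sphere_def Let_def dmin xz n n' n1 n2)
    next
      case 2
      then show ?thesis
        using d w0 by (simp add: triangle_to_sphere_def Let_def dmin xz n ph n1) (simp add: P_def)
    next
      case 3
      then show ?thesis
        using d w0 by (simp add: triangle_to_sphere_def Let_def dmin xz n ph n1) (simp add: Q_def)
    next
      case 4
      then show ?thesis using w(2) by (simp add: triangle_to_sphere_def Let_def)
    qed
  qed
  then have "triangle_to_sphere x y z = w" by blast
  then show ?thesis using pos sum1 by blast
qed

lemma continuous_map_triangle_to_sphere:
  assumes f: "continuous_map Z euclideanreal f" and g: "continuous_map Z euclideanreal g"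
    and h: "continuous_map Z euclideanreal h"
    and s: "\<And>z. z \<in> topspace Z \<Longrightarrow> f z + g z + h z = 1"
  shows "continuous_map Z (nsphere 2) (\<lambda>z. triangle_to_sphere (f z) (g z) (h z))"
proof -
  have ne: "(f z - h z)\<^sup>2 + (g z - h z)\<^sup>2 + (min (f z) (min (g z) (h z)))\<^sup>2 \<noteq> 0"
    if "z \<in> topspace Z" for z
    using triangle_to_sphere_denominator_pos[OF s[OF that]] by simp
  have c0: "continuous_map Z euclideanreal (\<lambda>z. ((f z - h z)\<^sup>2 + (g z - h z)\<^sup>2 - (min (f z) (min (g z) (h z)))\<^sup>2) /
      ((f z - h z)\<^sup>2 + (g z - h z)\<^sup>2 + (min (f z) (min (g z) (h z)))\<^sup>2))"
    using ne by (intro continuous_intros f g h)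
  have c1: "continuous_map Z euclideanreal (\<lambda>z. 2 * min (f z) (min (g z) (h z)) * (f z - h z) /
      ((f z - h z)\<^sup>2 + (g z - h z)\<^sup>2 + (min (f z) (min (g z) (h z)))\<^sup>2))"
    using ne by (intro continuous_intros f g h) auto
  have c2: "continuous_map Z euclideanreal (\<lambda>z. 2 * min (f z) (min (g z) (h z)) * (g z - h z) /
      ((f z - h z)\<^sup>2 + (g z - h z)\<^sup>2 + (min (f z) (min (g z) (h z)))\<^sup>2))"
    using ne by (intro continuous_intros f g h) auto
  have "continuous_map Z euclideanreal (\<lambda>z. triangle_to_sphere (f z) (g z) (h z) i)" for i
    using c0 c1 c2 by (simp add: triangle_to_sphere_def Let_def)
  then show ?thesis
    using triangle_to_sphere_in_sphere[OF s] unfolding nsphere continuous_map_in_subtopology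
    by (auto simp: continuous_map_componentwise_UNIV)
qed

section \<open>Attaching triangles along their boundaries\<close>

text \<open>The vertices of each triangle are ordered because the map to the sphere treats the three
  coordinates differently, and the triangles are numbered to match the index set of the wedge. The
  assumptions make them 2-cells with disjoint interiors, attached to \<open>K\<close> along their
  boundaries.\<close>

locale attached_triangles =
  fixes U :: "'b set" and K :: "'b set set" and k :: nat and a b c :: "nat \<Rightarrow> 'b"
  assumes finite_U: "finite U" and down_K: "down_closed K"
    and vertices: "i < k \<Longrightarrow> {a i, b i, c i} \<subseteq> U"
    and distinct_vertices: "i < k \<Longrightarrow> a i \<noteq> b i \<and> a i \<noteq> c i \<and> b i \<noteq> c i"
    and not_in_K: "i < k \<Longrightarrow> {a i, b i, c i} \<notin> K"
    and boundary: "i < k \<Longrightarrow> S \<subset> {a i, b i, c i} \<Longrightarrow> S \<in> K"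
    and triangle_inj: "i < k \<Longrightarrow> j < k \<Longrightarrow> {a i, b i, c i} = {a j, b j, c j} \<Longrightarrow> i = j"
begin

definition tr :: "nat \<Rightarrow> 'b set" where
  "tr i = {a i, b i, c i}"

abbreviation X :: "('b \<Rightarrow> real) topology" where
  "X \<equiv> realization U (K \<union> tr ` {..<k})"

abbreviation Y :: "('b \<Rightarrow> real) topology" where
  "Y \<equiv> realization U K"

text \<open>On \<open>X\<close> this is the depth below the boundary of a triangle: 1/3 at its
  barycentre, which is the maximum, and zero outside its interior.\<close>

definition dep :: "nat \<Rightarrow> ('b \<Rightarrow> real) \<Rightarrow> real" where
  "dep i x = min (x (a i)) (min (x (b i)) (x (c i)))"

lemma tr_U: "i < k \<Longrightarrow> tr i \<subseteq> U"
  using vertices by (simp add: tr_def)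

lemma abc_U: "i < k \<Longrightarrow> a i \<in> U" "i < k \<Longrightarrow> b i \<in> U" "i < k \<Longrightarrow> c i \<in> U"
  using vertices[of i] by auto

lemma tr_notin_K: "i < k \<Longrightarrow> tr i \<notin> K"
  using not_in_K by (simp add: tr_def)

lemma tr_inj: "i < k \<Longrightarrow> j < k \<Longrightarrow> tr i = tr j \<Longrightarrow> i = j"
  using triangle_inj by (simp add: tr_def)

lemma sum_tr: "i < k \<Longrightarrow> sum f (tr i) = f (a i) + f (b i) + (f (c i) :: real)"
  using distinct_vertices[of i] by (simp add: tr_def add.assoc)

lemma card_tr: "i < k \<Longrightarrow> card (tr i) = 3"
  using distinct_vertices[of i] by (simp add: tr_def)

lemma tr_subset_eq: "i < k \<Longrightarrow> j < k \<Longrightarrow> tr i \<subseteq> tr j \<Longrightarrow> i = j"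
  using card_subset_eq[of "tr j" "tr i"] card_tr tr_inj by (simp add: tr_def)

lemma X_coord:
  assumes "x \<in> topspace X"
  shows "x \<in> extensional U" "v \<in> U \<Longrightarrow> 0 \<le> x v" "(\<Sum>v\<in>U. x v) = 1"
  using assms by (auto simp: topspace_realization)

lemma Y_X: "x \<in> topspace Y \<Longrightarrow> x \<in> topspace X"
  by (auto simp: topspace_realization)

lemma Y_iff: "x \<in> topspace X \<Longrightarrow> x \<in> topspace Y \<longleftrightarrow> {v \<in> U. x v \<noteq> 0} \<in> K"
  by (auto simp: topspace_realization)

lemma dep_nonneg: "x \<in> topspace X \<Longrightarrow> i < k \<Longrightarrow> 0 \<le> dep i x"
  using X_coord(2)[of x] abc_U by (simp add: dep_def)

text \<open>Positive depth directly says only that the support contains \<open>tr i\<close>. As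
  \<open>tr i\<close> is not in \<open>K\<close>, neither is the support, so it is some attached
  triangle; having equally many vertices, the two coincide.\<close>

lemma dep_pos_iff:
  assumes "x \<in> topspace X" "i < k"
  shows "0 < dep i x \<longleftrightarrow> {v \<in> U. x v \<noteq> 0} = tr i"
proof -
  have "0 < dep i x \<longleftrightarrow> tr i \<subseteq> {v \<in> U. x v \<noteq> 0}"
    using X_coord(2)[OF assms(1)] abc_U[OF assms(2)]
    by (auto simp: dep_def tr_def order.strict_iff_order)
  moreover have "tr i = {v \<in> U. x v \<noteq> 0}" if sub: "tr i \<subseteq> {v \<in> U. x v \<noteq> 0}"
  proof -
    have "{v \<in> U. x v \<noteq> 0} \<notin> K"
      using sub tr_notin_K[OF assms(2)] down_closedD[OF down_K] by blast
    then obtain j where "j < k" "{v \<in> U. x v \<noteq> 0} = tr j"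
      using assms(1) by (auto simp: topspace_realization)
    then show ?thesis using tr_subset_eq[OF assms(2)] sub by metis
  qed
  ultimately show ?thesis by blast
qed

lemma dep_le_coord: "v \<in> tr i \<Longrightarrow> dep i x \<le> x v"
  by (auto simp: dep_def tr_def)

lemma X_cases:
  assumes x: "x \<in> topspace X"
  obtains (Y) "x \<in> topspace Y" "\<And>i. i < k \<Longrightarrow> dep i x = 0"
  | (tri) i where "i < k" "{v \<in> U. x v \<noteq> 0} = tr i" "0 < dep i x" "x \<notin> topspace Y"
      "\<forall>j<k. j \<noteq> i \<longrightarrow> dep j x = 0"
proof (cases "x \<in> topspace Y")
  case True
  have "dep i x = 0" if i: "i < k" for i
  proof (rule ccontr)
    assume "dep i x \<noteq> 0"
    then have "{v \<in> U. x v \<noteq> 0} = tr i" using dep_nonneg[OF x i] dep_pos_iff[OF x i] by simp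
    then show False using True tr_notin_K[OF i] by (simp add: topspace_realization)
  qed
  then show thesis using that(1) True by blast
next
  case False
  then obtain i where i: "i < k" "{v \<in> U. x v \<noteq> 0} = tr i"
    using x Y_iff[OF x] by (auto simp: topspace_realization)
  have "dep j x = 0" if j: "j < k" "j \<noteq> i" for j
  proof (rule ccontr)
    assume "dep j x \<noteq> 0"
    then have "{v \<in> U. x v \<noteq> 0} = tr j" using dep_nonneg[OF x j(1)] dep_pos_iff[OF x j(1)] by simp
    then show False using i tr_inj[OF i(1) j(1)] j by simp
  qed
  then show thesis using that(2)[OF i] dep_pos_iff[OF x i(1)] i(2) False by blast
qed

section \<open>Pushing triangles to their boundaries and extending the contraction\<close>

definition depth :: "('b \<Rightarrow> real) \<Rightarrow> real" where
  "depth x = (\<Sum>i<k. dep i x)"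

lemma depth_Y: "x \<in> topspace Y \<Longrightarrow> depth x = 0"
  using X_cases[OF Y_X] by (metis (no_types, lifting) depth_def lessThan_iff sum.neutral)

lemma depth_tri:
  assumes "i < k" "\<forall>j<k. j \<noteq> i \<longrightarrow> dep j x = 0"
  shows "depth x = dep i x"
  unfolding depth_def using assms by (subst sum.remove[of _ i]) (auto intro!: sum.neutral)

lemma depth_eq_0_iff: "x \<in> topspace X \<Longrightarrow> depth x = 0 \<longleftrightarrow> x \<in> topspace Y"
  by (erule X_cases) (auto simp: depth_Y depth_tri)

lemma continuous_map_dep: "i < k \<Longrightarrow> continuous_map X euclideanreal (dep i)"
  unfolding dep_def
  by (intro continuous_intros continuous_map_realization_coordinate abc_U)

lemma continuous_map_depth: "continuous_map X euclideanreal depth"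
  unfolding depth_def by (intro continuous_intros continuous_map_dep) auto

text \<open>At time \<open>s\<close> a point of a triangle is pushed away from the barycentre, up to the boundary
  if it is at depth at most \<open>s / 6\<close>.\<close>

definition push :: "real \<Rightarrow> ('b \<Rightarrow> real) \<Rightarrow> 'b \<Rightarrow> real" where
  "push s x = (\<lambda>v\<in>U. (x v - (\<Sum>i<k. if v \<in> tr i then min (dep i x) (s / 6) else 0)) /
     (1 - 3 * (\<Sum>i<k. min (dep i x) (s / 6))))"

lemma push_Y:
  assumes "x \<in> topspace Y" "0 \<le> s"
  shows "push s x = x"
proof -
  have "dep i x = 0" if "i < k" for i
    using X_cases[OF Y_X[OF assms(1)]] assms(1) that by metis
  then have "(\<Sum>i<k. min (dep i x) (s / 6)) = 0"
    "(\<Sum>i<k. if v \<in> tr i then min (dep i x) (s / 6) else 0) = 0" for v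
    using assms(2) by (auto intro!: sum.neutral)
  then show ?thesis
    using X_coord(1)[OF Y_X[OF assms(1)]] by (auto simp: push_def restrict_def extensional_def)
qed

lemma push_tri:
  assumes "i < k" "\<forall>j<k. j \<noteq> i \<longrightarrow> dep j x = 0" "0 \<le> s"
  shows "push s x = (\<lambda>v\<in>U. (x v - (if v \<in> tr i then min (dep i x) (s / 6) else 0)) /
     (1 - 3 * min (dep i x) (s / 6)))"
    and "(\<Sum>i<k. min (dep i x) (s / 6)) = min (dep i x) (s / 6)"
proof -
  have m: "min (dep j x) (s / 6) = 0" if "j < k" "j \<noteq> i" for j
    using assms(2,3) that by simp
  show 1: "(\<Sum>i<k. min (dep i x) (s / 6)) = min (dep i x) (s / 6)"
    using assms(1) m by (subst sum.remove[of _ i]) (auto intro!: sum.neutral)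
  have "(if v \<in> tr j then min (dep j x) (s / 6) else 0) = 0" if "j < k" "j \<noteq> i" for j v
    using m[OF that] by simp
  then have "(\<Sum>i<k. if v \<in> tr i then min (dep i x) (s / 6) else 0) =
      (if v \<in> tr i then min (dep i x) (s / 6) else 0)" for v
    using assms(1) by (subst sum.remove[of _ i]) (auto intro!: sum.neutral)
  then show "push s x = (\<lambda>v\<in>U. (x v - (if v \<in> tr i then min (dep i x) (s / 6) else 0)) /
     (1 - 3 * min (dep i x) (s / 6)))"
    unfolding push_def 1 by simp
qed

text \<open>This is the reason for the divisor 6: at most 1/6 is taken from each of three
  coordinates, so at least half of the mass remains.\<close>

lemma push_denominator_pos:
  assumes x: "x \<in> topspace X" and s: "0 \<le> s" "s \<le> 1"
  shows "1 - 3 * (\<Sum>i<k. min (dep i x) (s / 6)) > 0"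
  using x
proof (cases rule: X_cases)
  case Y
  then have "(\<Sum>i<k. min (dep i x) (s / 6)) = 0"
    using s by (intro sum.neutral) auto
  then show ?thesis by simp
next
  case (tri i)
  have "min (dep i x) (s / 6) \<le> s / 6" by simp
  then show ?thesis
    unfolding push_tri(2)[OF tri(1,5) s(1)] using s by linarith
qed

text \<open>Subtracting one amount from all three coordinates and rescaling keeps the total mass 1.
  If the depth is at most \<open>s / 6\<close>, this amount is the smallest coordinate, which drops
  to zero, and the point lands on the boundary.\<close>

lemma push_in:
  assumes x: "x \<in> topspace X" and s: "0 \<le> s" "s \<le> 1"
  shows "push s x \<in> topspace X" "depth x \<le> s / 6 \<Longrightarrow> push s x \<in> topspace Y"
proof -
  have "push s x \<in> topspace X \<and> (depth x \<le> s / 6 \<longrightarrow> push s x \<in> topspace Y)"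
    using x
  proof (cases rule: X_cases)
    case Y
    then show ?thesis using x push_Y s by simp
  next
    case (tri i)
    define m where "m = min (dep i x) (s / 6)"
    have m: "0 \<le> m" "m \<le> dep i x" "3 * m < 1"
      using s tri(3) by (auto simp: m_def min_def)
    have p: "push s x = (\<lambda>v\<in>U. (x v - (if v \<in> tr i then m else 0)) / (1 - 3 * m))"
      unfolding m_def by (rule push_tri(1)[OF tri(1,5) s(1)])
    have pos: "0 \<le> push s x v" if v: "v \<in> U" for v
      using X_coord(2)[OF x v] dep_le_coord[of v i x] m v by (auto simp: p intro!: divide_nonneg_nonneg)
    have "(\<Sum>v\<in>U. push s x v) = (\<Sum>v\<in>U. x v - (if v \<in> tr i then m else 0)) / (1 - 3 * m)"
      by (simp add: p sum_divide_distrib)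
    also have "(\<Sum>v\<in>U. x v - (if v \<in> tr i then m else 0)) = 1 - (\<Sum>v\<in>U. if v \<in> tr i then m else 0)"
      using X_coord(3)[OF x] by (simp add: sum_subtractf)
    also have "(\<Sum>v\<in>U. if v \<in> tr i then m else 0) = (\<Sum>v\<in>tr i. m)"
      using finite_U tr_U[OF tri(1)] by (simp add: sum.inter_restrict[symmetric] Int_absorb1)
    also have "\<dots> = 3 * m" using card_tr[OF tri(1)] by simp
    finally have sum1: "(\<Sum>v\<in>U. push s x v) = 1" using m by simp
    have supp: "{v \<in> U. push s x v \<noteq> 0} \<subseteq> tr i"
      using tri(2) by (auto simp: p split: if_splits)
    then have "{v \<in> U. push s x v \<noteq> 0} = tr i \<or> {v \<in> U. push s x v \<noteq> 0} \<in> K"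
      using boundary[OF tri(1)] by (auto simp: tr_def[symmetric])
    then have "{v \<in> U. push s x v \<noteq> 0} \<in> K \<union> tr ` {..<k}"
      using tri(1) by auto
    then have 1: "push s x \<in> topspace X"
      unfolding topspace_realization using pos sum1 by (simp add: push_def)
    have "push s x \<in> topspace Y" if "depth x \<le> s / 6"
    proof -
      have "dep i x = m" using that depth_tri[OF tri(1,5)] by (simp add: m_def)
      then obtain v where "v \<in> tr i" "x v = m"
        by (auto simp: dep_def tr_def min_def split: if_splits)
      then have "v \<in> tr i - {v \<in> U. push s x v \<noteq> 0}" by (auto simp: p)
      then have "{v \<in> U. push s x v \<noteq> 0} \<subset> tr i" using supp by blast
      then have "{v \<in> U. push s x v \<noteq> 0} \<in> K" using boundary[OF tri(1)] by (simp add: tr_def)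
      then show ?thesis using Y_iff[OF 1] by simp
    qed
    with 1 show ?thesis by blast
  qed
  then show "push s x \<in> topspace X" "depth x \<le> s / 6 \<Longrightarrow> push s x \<in> topspace Y" by auto
qed

text \<open>An explicit homotopy extension. A point of a triangle is pushed until, at time
  \<open>6 * depth x\<close>, it reaches the boundary; if time remains, it then follows the
  contraction \<open>h\<close> of \<open>Y\<close>. The two rules agree at the switch because
  \<open>h\<close> starts with the identity.\<close>

lemma ex_homotopy_extension:
  assumes "contractible_space Y"
  obtains H z where "continuous_map (prod_topology (top_of_set {0..1::real}) X) X H"
    "\<And>x. x \<in> topspace X \<Longrightarrow> H (0, x) = x"
    "\<And>t x. \<lbrakk>0 \<le> t; t \<le> 1; x \<in> topspace Y\<rbrakk> \<Longrightarrow> H (t, x) \<in> topspace Y"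
    "\<And>x. x \<in> topspace Y \<Longrightarrow> H (1, x) = z"
proof -
  let ?I = "top_of_set {0..1::real}"
  let ?P = "prod_topology ?I X"
  obtain z h where h: "continuous_map (prod_topology ?I Y) Y h"
    and h0: "\<And>x. h (0, x) = x" and h1: "\<And>x. h (1, x) = z"
    using assms by (auto simp: contractible_space_def homotopic_with_def)
  define H where "H = (\<lambda>p. if fst p / 6 \<le> depth (snd p) then push (fst p) (snd p)
    else h (fst p - 6 * depth (snd p), push (fst p) (snd p)))"
  have cfst: "continuous_map ?P euclideanreal fst"
    using continuous_map_fst continuous_map_into_fulltopology by blast
  have csnd: "continuous_map ?P euclideanreal (\<lambda>p. f (snd p))"
    if "continuous_map X euclideanreal f" for f
    using continuous_map_compose[OF continuous_map_snd that] by (simp add: o_def)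
  have cdepth: "continuous_map ?P euclideanreal (\<lambda>p. depth (snd p))"
    by (rule csnd[OF continuous_map_depth])
  have depth0: "0 \<le> depth x" if "x \<in> topspace X" for x
    unfolding depth_def using dep_nonneg[OF that] by (auto intro: sum_nonneg)
  have PD: "0 \<le> fst p" "fst p \<le> 1" "snd p \<in> topspace X" if "p \<in> topspace ?P" for p
    using that by auto
  have cpush: "continuous_map ?P euclideanreal (\<lambda>p. push (fst p) (snd p) v)" if v: "v \<in> U" for v
  proof -
    have cm: "continuous_map ?P euclideanreal (\<lambda>p. min (dep i (snd p)) (fst p / 6))" if "i < k" for i
      using csnd[OF continuous_map_dep[OF that]] by (intro continuous_intros cfst) auto
    then have cm': "continuous_map ?P euclideanreal
        (\<lambda>p. if v \<in> tr i then min (dep i (snd p)) (fst p / 6) else 0)" if "i < k" for i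
      using that by (cases "v \<in> tr i") auto
    have "continuous_map ?P euclideanreal (\<lambda>p. (snd p v -
        (\<Sum>i<k. if v \<in> tr i then min (dep i (snd p)) (fst p / 6) else 0)) /
       (1 - 3 * (\<Sum>i<k. min (dep i (snd p)) (fst p / 6))))"
    proof (rule continuous_map_real_divide)
      show "continuous_map ?P euclideanreal (\<lambda>p. snd p v -
        (\<Sum>i<k. if v \<in> tr i then min (dep i (snd p)) (fst p / 6) else 0))"
        by (intro continuous_map_diff continuous_map_sum cm'
            csnd[OF continuous_map_realization_coordinate[OF v]]) auto
      show "continuous_map ?P euclideanreal (\<lambda>p. 1 - 3 * (\<Sum>i<k. min (dep i (snd p)) (fst p / 6)))"
        by (intro continuous_map_diff continuous_map_real_mult_left continuous_map_sum cm) auto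
      show "1 - 3 * (\<Sum>i<k. min (dep i (snd p)) (fst p / 6)) \<noteq> 0" if "p \<in> topspace ?P" for p
        using push_denominator_pos[OF PD(3)[OF that] PD(1,2)[OF that]] by simp
    qed
    then show ?thesis using v by (simp add: push_def)
  qed
  have "continuous_map ?P X H"
    unfolding H_def
  proof (rule continuous_map_cases_le)
    show "continuous_map ?P euclideanreal (\<lambda>p. fst p / 6)"
      by (intro continuous_intros cfst) auto
    show "continuous_map (subtopology ?P {p \<in> topspace ?P. fst p / 6 \<le> depth (snd p)}) X
       (\<lambda>p. push (fst p) (snd p))"
      by (intro continuous_map_from_subtopology continuous_map_into_realization cpush)
        (use push_in(1) PD in blast)+
    let ?Q = "subtopology ?P {p \<in> topspace ?P. depth (snd p) \<le> fst p / 6}"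
    have QD: "p \<in> topspace ?P" "depth (snd p) \<le> fst p / 6" if "p \<in> topspace ?Q" for p
      using that by auto
    have 1: "continuous_map ?Q Y (\<lambda>p. push (fst p) (snd p))"
    proof (rule continuous_map_into_realization)
      show "push (fst p) (snd p) \<in> topspace Y" if "p \<in> topspace ?Q" for p
        using push_in(2) PD QD[OF that] by blast
      show "continuous_map ?Q euclideanreal (\<lambda>p. push (fst p) (snd p) v)" if "v \<in> U" for v
        by (rule continuous_map_from_subtopology[OF cpush[OF that]])
    qed
    have 2: "continuous_map ?Q ?I (\<lambda>p. fst p - 6 * depth (snd p))"
    proof (rule continuous_map_into_subtopology)
      show "continuous_map ?Q euclideanreal (\<lambda>p. fst p - 6 * depth (snd p))"
        by (intro continuous_map_from_subtopology continuous_intros cfst cdepth) auto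
      have "0 \<le> fst p - 6 * depth (snd p) \<and> fst p - 6 * depth (snd p) \<le> 1" if p: "p \<in> topspace ?Q" for p
        using depth0[OF PD(3)] PD[OF QD(1)[OF p]] QD[OF p] by fastforce
      then show "(\<lambda>p. fst p - 6 * depth (snd p)) \<in> topspace ?Q \<rightarrow> {0..1}" by auto
    qed
    have "continuous_map ?Q (prod_topology ?I Y)
       (\<lambda>p. (fst p - 6 * depth (snd p), push (fst p) (snd p)))"
      using 1 2 by (simp add: continuous_map_pairwise o_def)
    from continuous_map_compose[OF continuous_map_compose[OF this h] 
        continuous_map_realization_mono[of K "K \<union> tr ` {..<k}" U]]
    show "continuous_map ?Q X (\<lambda>p. h (fst p - 6 * depth (snd p), push (fst p) (snd p)))"
      by (simp add: o_def)
    show "push (fst p) (snd p) = h (fst p - 6 * depth (snd p), push (fst p) (snd p))"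
      if "fst p / 6 = depth (snd p)" for p
      using that h0 by (simp flip: that)
  qed (rule cdepth)
  moreover have "H (0, x) = x" if x: "x \<in> topspace X" for x
  proof -
    have "push 0 x = x"
    proof -
      have "min (dep i x) (0 / 6) = 0" if "i < k" for i using dep_nonneg[OF x that] by simp
      then have "(\<Sum>i<k. min (dep i x) (0 / 6)) = 0"
        "(\<Sum>i<k. if v \<in> tr i then min (dep i x) (0 / 6) else 0) = 0" for v
        by (auto intro!: sum.neutral)
      then show ?thesis
        using X_coord(1)[OF x] by (auto simp: push_def restrict_def extensional_def)
    qed
    then show ?thesis using depth0[OF x] by (simp add: H_def)
  qed
  \<comment> \<open>On \<open>Y\<close> the depth is zero and the push does nothing, so all the time
    is spent on \<open>h\<close>.\<close>
  moreover have HY: "H (t, x) = h (t, x)" if "0 \<le> t" "t \<le> 1" "x \<in> topspace Y" for t x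
    using that depth_Y push_Y h0 by (simp add: H_def)
  then have "H (t, x) \<in> topspace Y" if "0 \<le> t" "t \<le> 1" "x \<in> topspace Y" for t x
    using that h by (auto simp: continuous_map_def)
  moreover have "H (1, x) = z" if "x \<in> topspace Y" for x
    using HY that h1 by simp
  ultimately show thesis using that[of H z] by blast
qed

section \<open>The collapse map onto the wedge of spheres\<close>

abbreviation W :: "(nat \<times> (nat \<Rightarrow> real)) option topology" where
  "W \<equiv> wedge_of_spheres 2 k"

definition \<Phi> :: "nat \<Rightarrow> ('b \<Rightarrow> real) \<Rightarrow> nat \<Rightarrow> real" where
  "\<Phi> i x = triangle_to_sphere (x (a i)) (x (b i)) (x (c i))"

text \<open>For a point of \<open>X\<close> outside \<open>Y\<close> exactly one depth is positive,
  so the description picks the triangle whose interior contains it.\<close>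

definition collapse :: "('b \<Rightarrow> real) \<Rightarrow> (nat \<times> (nat \<Rightarrow> real)) option" where
  "collapse x = (if x \<in> topspace Y then None
     else let i = (THE i. i < k \<and> 0 < dep i x) in Some (i, \<Phi> i x))"

lemma collapse_tri:
  assumes "i < k" "0 < dep i x" "x \<notin> topspace Y" "\<forall>j<k. j \<noteq> i \<longrightarrow> dep j x = 0"
  shows "collapse x = Some (i, \<Phi> i x)"
proof -
  have "(THE i. i < k \<and> 0 < dep i x) = i"
    using assms by (intro the_equality) (auto intro: ccontr)
  then show ?thesis using assms(3) by (simp add: collapse_def)
qed

definition cell :: "nat \<Rightarrow> ('b \<Rightarrow> real) topology" where
  "cell i = realization U (Pow (tr i))"

lemma cell_sum:
  assumes "i < k" "x \<in> topspace (cell i)"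
  shows "x (a i) + x (b i) + x (c i) = 1"
proof -
  have "sum x (tr i) = sum x U"
    using assms tr_U[OF assms(1)] finite_U
    by (intro sum.mono_neutral_left) (auto simp: cell_def topspace_realization)
  then show ?thesis using assms sum_tr[OF assms(1), of x] by (simp add: cell_def topspace_realization)
qed

lemma cell_X: "i < k \<Longrightarrow> x \<in> topspace (cell i) \<Longrightarrow> x \<in> topspace X"
  using boundary[of i "{v \<in> U. x v \<noteq> 0}"]
  by (auto simp: cell_def topspace_realization simp flip: tr_def)

lemma cell_iff:
  assumes "i < k" "x \<in> topspace X"
  shows "x \<in> topspace (cell i) \<longleftrightarrow> (\<forall>v\<in>U - tr i. x v = 0)"
  using assms by (auto simp: cell_def topspace_realization)

text \<open>One formula covers the interior and the boundary of a closed triangle: on the boundary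
  the smallest coordinate is 0, so \<Phi> gives the base point, which \<open>wedge_map\<close> sends
  to \<open>None\<close>.\<close>

lemma collapse_cell:
  assumes i: "i < k" and x: "x \<in> topspace (cell i)"
  shows "collapse x = wedge_map (\<lambda>_. sphere_base) (i, \<Phi> i x)"
  using cell_X[OF i x]
proof (cases rule: X_cases)
  case Y
  then have "\<Phi> i x = sphere_base"
    unfolding \<Phi>_def triangle_to_sphere_eq_base_iff[OF cell_sum[OF i x]] using i by (simp add: dep_def)
  then show ?thesis using Y by (simp add: collapse_def wedge_map_def)
next
  case (tri j)
  have "tr j \<subseteq> tr i" using x tri(2) by (auto simp: cell_def topspace_realization)
  then have "j = i" using tr_subset_eq tri(1) i by blast
  then have "dep i x \<noteq> 0" using tri(3) by simp
  then have "\<Phi> i x \<noteq> sphere_base"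
    unfolding \<Phi>_def triangle_to_sphere_eq_base_iff[OF cell_sum[OF i x]] dep_def .
  then show ?thesis
    using collapse_tri[OF tri(1,3,4,5)] \<open>j = i\<close> by (simp add: wedge_map_def)
qed

lemma continuous_map_\<Phi>:
  assumes "i < k" "\<And>x. x \<in> topspace Z \<Longrightarrow> x \<in> topspace (cell i)"
    "\<And>v. v \<in> U \<Longrightarrow> continuous_map Z euclideanreal (\<lambda>x. x v)"
  shows "continuous_map Z (nsphere 2) (\<Phi> i)"
  unfolding \<Phi>_def using assms abc_U cell_sum by (intro continuous_map_triangle_to_sphere) auto

lemma continuous_map_wedge_inclusion:
  assumes "i < k"
  shows "continuous_map (nsphere 2) W (\<lambda>y. wedge_map (\<lambda>_. sphere_base) (i, y))"
proof -
  let ?S = "sum_topology (\<lambda>_. nsphere 2) {..<k}"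
  have "quotient_map ?S W (wedge_map (\<lambda>_. sphere_base))"
    unfolding wedge_of_spheres_def using assms sphere_base_in_nsphere
    by (intro quotient_map_wedge_sum) auto
  moreover have "continuous_map (nsphere 2) ?S (\<lambda>y. (i, y))"
    using continuous_map_component_injection[of i "{..<k}" "\<lambda>_. nsphere 2"] assms by simp
  ultimately show ?thesis
    using continuous_map_compose[OF _ quotient_imp_continuous_map] by (fastforce simp: o_def)
qed

text \<open>Pasting over the finite closed cover by \<open>Y\<close>, where the map is constant, and
  the closed triangles, where it is \<Phi> followed by the inclusion of a sphere.\<close>

lemma continuous_map_collapse: "continuous_map X W collapse"
proof -
  define T where "T = (\<lambda>j. case j of None \<Rightarrow> topspace Y | Some i \<Rightarrow> topspace (cell i))"
  let ?I = "insert None (Some ` {..<k})"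
  have TX: "T j \<subseteq> topspace X" if "j \<in> ?I" for j
    using that cell_X Y_X by (auto simp: T_def)
  show ?thesis
  proof (rule pasting_lemma_closed[where I = ?I and T = T and f = "\<lambda>_. collapse"])
    show "closedin X (T j)" if j: "j \<in> ?I" for j
    proof (cases j)
      case None
      have "{x \<in> topspace X. depth x \<in> {0}} = T j"
        using depth_eq_0_iff Y_X None by (auto simp: T_def)
      then show ?thesis
        using closedin_continuous_map_preimage[OF continuous_map_depth, of "{0}"] by simp
    next
      case (Some i)
      then have i: "i < k" using j by auto
      \<comment> \<open>The coordinates are nonnegative, so the closed triangle is the zero set of
        this single sum.\<close>
      have "continuous_map X euclideanreal (\<lambda>x. \<Sum>v\<in>U - tr i. x v)"
        using finite_U by (intro continuous_map_sum continuous_map_realization_coordinate) auto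
      moreover have "{x \<in> topspace X. (\<Sum>v\<in>U - tr i. x v) \<in> {0}} = T j"
      proof -
        have "(\<Sum>v\<in>U - tr i. x v) = 0 \<longleftrightarrow> x \<in> topspace (cell i)" if x: "x \<in> topspace X" for x
          unfolding cell_iff[OF i x] using finite_U X_coord(2)[OF x]
          by (intro sum_nonneg_eq_0_iff) auto
        then show ?thesis using TX[OF j] Some by (auto simp: T_def)
      qed
      ultimately show ?thesis
        using closedin_continuous_map_preimage[of X euclideanreal _ "{0}"] by fastforce
    qed
    show "continuous_map (subtopology X (T j)) W collapse" if j: "j \<in> ?I" for j
    proof (cases j)
      case None
      have "continuous_map (subtopology X (T j)) W (\<lambda>_. None)"
        by (simp add: wedge_of_spheres_def topspace_wedge_sum)
      then show ?thesis
        by (rule continuous_map_eq) (use None in \<open>auto simp: T_def collapse_def\<close>)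
    next
      case (Some i)
      then have i: "i < k" using j by auto
      have "continuous_map (subtopology X (T j)) (nsphere 2) (\<Phi> i)"
        by (rule continuous_map_\<Phi>[OF i])
          (use Some in \<open>auto simp: T_def intro: continuous_map_from_subtopology continuous_map_realization_coordinate\<close>)
      from continuous_map_compose[OF this continuous_map_wedge_inclusion[OF i]]
      show ?thesis
        by (rule continuous_map_eq) (use Some collapse_cell[OF i] in \<open>auto simp: T_def\<close>)
    qed
    show "\<exists>j. j \<in> ?I \<and> x \<in> T j \<and> collapse x = collapse x" if x: "x \<in> topspace X" for x
      using x
    proof (cases rule: X_cases)
      case Y
      then show ?thesis by (intro exI[of _ None]) (auto simp: T_def)
    next
      case (tri i)
      then have "x \<in> topspace (cell i)" unfolding cell_iff[OF tri(1) x] by blast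
      then show ?thesis using tri(1) by (intro exI[of _ "Some i"]) (auto simp: T_def)
    qed
  qed auto
qed

lemma compact_space_cell:
  assumes i: "i < k"
  shows "compact_space (cell i)"
proof -
  let ?P = "powertop_real U"
  let ?C = "{x. (\<forall>v\<in>U. 0 \<le> x v) \<and> {v \<in> U. x v \<noteq> 0} \<in> Pow (tr i) \<and> (\<Sum>v\<in>U. x v) = (1::real)}"
  let ?A = "topspace ?P \<inter> ?C"
  have coord: "continuous_map ?P euclideanreal (\<lambda>x. x v)" if "v \<in> U" for v
    by (rule continuous_map_product_projection[OF that])
  have "compactin ?P (PiE U (\<lambda>_. {0..1}))"
    by (simp add: compactin_PiE)
  moreover have "?A \<subseteq> PiE U (\<lambda>_. {0..1})"
  proof
    fix x assume x: "x \<in> ?A"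
    have "x v \<le> 1" if "v \<in> U" for v
      using member_le_sum[OF that _ finite_U, of x] x by auto
    then show "x \<in> PiE U (\<lambda>_. {0..1})" using x by (auto simp: PiE_iff)
  qed
  moreover have "closedin ?P ?A"
  proof -
    \<comment> \<open>\<open>insert (a i) U\<close> equals \<open>U\<close>; it is written this way
      so that the intersections are visibly over a nonempty index set.\<close>
    have "?A = {x \<in> topspace ?P. (\<Sum>v\<in>U. x v) \<in> {1}} \<inter> (\<Inter>v\<in>insert (a i) U. {x \<in> topspace ?P. x v \<in> {0..}})
       \<inter> (\<Inter>v\<in>insert (a i) U. {x \<in> topspace ?P. (if v \<in> tr i then 0 else x v) \<in> {0}})"
      using abc_U(1)[OF i] by (auto simp: tr_def split: if_splits)
    also have "closedin ?P \<dots>"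
    proof (intro closedin_Int closedin_INT closedin_continuous_map_preimage[where Y = euclideanreal])
      show "continuous_map ?P euclideanreal (\<lambda>x. \<Sum>v\<in>U. x v)"
        using finite_U by (intro continuous_map_sum coord) auto
      fix v assume "v \<in> insert (a i) U"
      then have v: "v \<in> U" using abc_U(1)[OF i] by auto
      show "continuous_map ?P euclideanreal (\<lambda>x. x v)" by (rule coord[OF v])
      show "continuous_map ?P euclideanreal (\<lambda>x. if v \<in> tr i then 0 else x v)"
        using coord[OF v] by (cases "v \<in> tr i") auto
    qed auto
    finally show ?thesis .
  qed
  ultimately have "compactin ?P ?A" by (rule closed_compactin)
  then have "compact_space (subtopology ?P ?A)" by (rule compact_space_subtopology)
  then show ?thesis
    unfolding cell_def realization_def using subtopology_restrict[of ?P ?C] by simp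
qed

lemma \<Phi>_surj:
  assumes i: "i < k" and y: "y \<in> topspace (nsphere 2)"
  shows "\<exists>x\<in>topspace (cell i). \<Phi> i x = y"
proof -
  obtain p q r where pqr: "0 \<le> p" "0 \<le> q" "0 \<le> r" "p + q + r = 1" "triangle_to_sphere p q r = y"
    using triangle_to_sphere_surj[OF y] by blast
  let ?x = "\<lambda>v\<in>U. if v = a i then p else if v = b i then q else if v = c i then r else 0"
  have abc: "?x (a i) = p" "?x (b i) = q" "?x (c i) = r"
    using abc_U[OF i] distinct_vertices[OF i] by auto
  have supp: "{v \<in> U. ?x v \<noteq> 0} \<subseteq> tr i" by (auto simp: tr_def split: if_splits)
  have "sum ?x U = sum ?x (tr i)"
    using supp tr_U[OF i] finite_U by (intro sum.mono_neutral_right) auto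
  also have "\<dots> = 1"
    unfolding sum_tr[OF i] abc by (rule pqr(4))
  finally have "?x \<in> topspace (cell i)"
    unfolding cell_def topspace_realization using supp pqr by auto
  moreover have "\<Phi> i ?x = y"
    unfolding \<Phi>_def abc by (rule pqr(5))
  ultimately show ?thesis by blast
qed

lemma quotient_map_\<Phi>: 
  assumes i: "i < k"
  shows "quotient_map (cell i) (nsphere 2) (\<Phi> i)"
proof (rule continuous_imp_quotient_map)
  show c: "continuous_map (cell i) (nsphere 2) (\<Phi> i)"
    by (rule continuous_map_\<Phi>[OF i]) (auto simp: cell_def intro: continuous_map_realization_coordinate)
  show "Hausdorff_space (nsphere 2)"
    unfolding nsphere by (intro Hausdorff_space_subtopology) (simp add: Hausdorff_space_product_topology)
  show "\<Phi> i ` topspace (cell i) = topspace (nsphere 2)"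
    using \<Phi>_surj[OF i] continuous_map_image_subset_topspace[OF c] by blast
qed (rule compact_space_cell[OF i])

text \<open>Openness in the wedge can be tested on each sphere, and each sphere is a quotient of a
  closed triangle, which includes continuously into \<open>X\<close>. A point of \<open>Y\<close> is
  needed as preimage of \<open>None\<close>, which is present even in the empty wedge.\<close>

lemma quotient_map_collapse:
  assumes "topspace Y \<noteq> {}"
  shows "quotient_map X W collapse"
proof -
  let ?S = "sum_topology (\<lambda>_. nsphere 2) {..<k}"
  let ?w = "wedge_map (\<lambda>_. sphere_base)"
  have tW: "topspace W = insert None (?w ` topspace ?S)"
    by (simp add: wedge_of_spheres_def topspace_wedge_sum)
  have "topspace W \<subseteq> collapse ` topspace X"
  proof -
    obtain x where "x \<in> topspace Y" using assms by blast
    then have "collapse x = None" "x \<in> topspace X" using Y_X by (simp_all add: collapse_def)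
    then have "None \<in> collapse ` topspace X" by (metis imageI)
    moreover have "?w (i, y) \<in> collapse ` topspace X" if "i < k" "y \<in> topspace (nsphere 2)" for i y
      using \<Phi>_surj[OF that] collapse_cell[OF that(1)] cell_X[OF that(1)] by (metis imageI)
    ultimately show ?thesis unfolding tW by auto
  qed
  then have surj: "collapse ` topspace X = topspace W"
    using continuous_map_image_subset_topspace[OF continuous_map_collapse] by blast
  moreover have "openin W V" if V: "V \<subseteq> topspace W" and o: "openin X {x \<in> topspace X. collapse x \<in> V}" for V
  proof -
    have "openin (nsphere 2) {y \<in> topspace (nsphere 2). ?w (i, y) \<in> V}" if i: "i < k" for i
    proof -
      have "continuous_map (cell i) X id"
        by (rule continuous_map_into_realization)
          (use cell_X[OF i] in \<open>auto simp: cell_def intro: continuous_map_realization_coordinate\<close>)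
      from openin_continuous_map_preimage[OF this o]
      have "openin (cell i) {x \<in> topspace (cell i). x \<in> topspace X \<and> collapse x \<in> V}" by simp
      moreover have "{x \<in> topspace (cell i). x \<in> topspace X \<and> collapse x \<in> V} =
          {x \<in> topspace (cell i). \<Phi> i x \<in> {y \<in> topspace (nsphere 2). ?w (i, y) \<in> V}}"
        using cell_X[OF i] collapse_cell[OF i]
          continuous_map_image_subset_topspace[OF quotient_imp_continuous_map[OF quotient_map_\<Phi>[OF i]]]
        by (intro Collect_cong) (auto simp: image_subset_iff)
      ultimately have op: "openin (cell i)
          {x \<in> topspace (cell i). \<Phi> i x \<in> {y \<in> topspace (nsphere 2). ?w (i, y) \<in> V}}"
        by (simp only:)
      have "openin (nsphere 2) B"
        if "B \<subseteq> topspace (nsphere 2)" "openin (cell i) {x \<in> topspace (cell i). \<Phi> i x \<in> B}" for B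
        using quotient_map_\<Phi>[OF i] that unfolding quotient_map_def by blast
      from this[OF _ op] show ?thesis by simp
    qed
    then have "openin ?S {z \<in> topspace ?S. ?w z \<in> V}"
      by (auto simp: openin_sum_topology)
    then show ?thesis
      using V unfolding tW by (simp add: wedge_of_spheres_def openin_wedge_sum)
  qed
  ultimately show ?thesis
    unfolding quotient_map_def using openin_continuous_map_preimage[OF continuous_map_collapse] by blast
qed

theorem homotopy_equivalent_wedge:
  assumes contr: "contractible_space Y" and ne: "topspace Y \<noteq> {}"
  shows "X homotopy_equivalent_space W"
proof -
  obtain H z where H: "continuous_map (prod_topology (top_of_set {0..1::real}) X) X H"
    "\<And>x. x \<in> topspace X \<Longrightarrow> H (0, x) = x"
    "\<And>t x. \<lbrakk>0 \<le> t; t \<le> 1; x \<in> topspace Y\<rbrakk> \<Longrightarrow> H (t, x) \<in> topspace Y"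
    "\<And>x. x \<in> topspace Y \<Longrightarrow> H (1, x) = z"
    using ex_homotopy_extension[OF contr] by blast
  show ?thesis
  proof (rule homotopy_equivalent_space_quotient[OF quotient_map_collapse[OF ne] _ H])
    show "topspace Y \<subseteq> topspace X" using Y_X by blast
    show "collapse x = collapse y" if "x \<in> topspace Y" "y \<in> topspace Y" for x y
      using that by (simp add: collapse_def)
    \<comment> \<open>Outside \<open>Y\<close> the index inside \<open>Some\<close> identifies the
      triangle, and \<Phi> is injective on its interior.\<close>
    show "x = y \<or> x \<in> topspace Y \<and> y \<in> topspace Y"
      if x: "x \<in> topspace X" and y: "y \<in> topspace X" and eq: "collapse x = collapse y" for x y
      using x
    proof (cases rule: X_cases)
      case Y
      then have "collapse y = None" using eq by (simp add: collapse_def)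
      then have "y \<in> topspace Y" by (auto simp: collapse_def Let_def split: if_splits)
      then show ?thesis using Y by blast
    next
      case (tri i)
      note x' = tri
      have cx: "collapse x = Some (i, \<Phi> i x)" by (rule collapse_tri[OF tri(1,3,4,5)])
      show ?thesis using y
      proof (cases rule: X_cases)
        case Y
        then show ?thesis using cx eq by (simp add: collapse_def)
      next
        case (tri j)
        have "Some (j, \<Phi> j y) = Some (i, \<Phi> i x)" 
          unfolding collapse_tri[OF tri(1,3,4,5), symmetric] cx[symmetric] by (rule eq[symmetric])
        then have j: "j = i" and \<Phi>: "\<Phi> i x = \<Phi> i y" by auto
        have xc: "x \<in> topspace (cell i)" and yc: "y \<in> topspace (cell i)"
          unfolding cell_iff[OF x'(1) x] cell_iff[OF x'(1) y] using x'(2) tri(2) j by blast+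
        have "x (a i) = y (a i) \<and> x (b i) = y (b i) \<and> x (c i) = y (c i)"
          using triangle_to_sphere_inj[OF cell_sum[OF x'(1) xc] cell_sum[OF x'(1) yc]]
            x'(3) tri(3) j \<Phi> by (simp add: dep_def \<Phi>_def)
        moreover have "x v = 0" "y v = 0" if "v \<in> U" "v \<notin> tr i" for v
          using that x'(2) tri(2) j by blast+
        ultimately have "x v = y v" if "v \<in> U" for v
          using that by (cases "v \<in> tr i") (auto simp: tr_def)
        then have "x = y"
          using X_coord(1)[OF x] X_coord(1)[OF y] by (rule extensionalityI[rotated 2])
        then show ?thesis by blast
      qed
    qed
  qed
qed

end

section \<open>The homotopy type\<close>

theorem theorem3p5:
  fixes V :: "'a set" and E :: "'a set set"
  assumes "simple_graph V E"
    and "connected_graph V E"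
    and "chordal V E"
    and "E \<noteq> {}"
  shows "\<exists>k. geometric_realization (line_clique_complex E)
               homotopy_equivalent_space wedge_of_spheres 2 k"
proof -
  note G = \<open>simple_graph V E\<close>
  have edge: "e \<subseteq> V" "card e = 2" if "e \<in> E" for e
    using G that by (auto simp: simple_graph_def)
  have finE: "finite E"
    using G edge by (auto simp: simple_graph_def intro: finite_subset[of E "Pow V"])
  have "V \<noteq> {}" using assms(2) by (simp add: connected_graph_def)
  obtain T where T: "T \<subseteq> triangles E"
    and contr: "contractible_space (realization E (faces (star E ` V \<union> T)))"
    using ex_contractible_subcomplex[OF assms finE order_refl] by blast
  define K where "K = faces (star E ` V \<union> T)"
  define R where "R = triangles E - K"
  have triE: "t \<subseteq> E" if "t \<in> triangles E" for t
    using star_Un_subset_edges[OF order_refl, of t E V] that by blast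
  have "finite R"
    using finE triE by (intro finite_subset[of R "Pow E"]) (auto simp: R_def)
  then obtain \<tau> where \<tau>: "bij_betw \<tau> {..<card R} R"
    using ex_bij_betw_nat_finite[of R] by (auto simp: lessThan_atLeast0)
  define k where "k = card R"
  have \<tau>R: "\<tau> i \<in> R" if "i < k" for i
    using \<tau> that by (auto simp: bij_betw_def k_def)
  have "\<exists>x y z. \<tau> i = {{x, y}, {x, z}, {y, z}} \<and> x \<noteq> y \<and> x \<noteq> z \<and> y \<noteq> z \<and> {{x, y}, {x, z}, {y, z}} \<subseteq> E"
    if "i < k" for i
    using \<tau>R[OF that] unfolding R_def triangles_def by auto
  then obtain x y z where xyz: "\<And>i. i < k \<Longrightarrow> \<tau> i = {{x i, y i}, {x i, z i}, {y i, z i}} \<and>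
      x i \<noteq> y i \<and> x i \<noteq> z i \<and> y i \<noteq> z i \<and> {{x i, y i}, {x i, z i}, {y i, z i}} \<subseteq> E"
    by metis
  \<comment> \<open>The vertices of the attached 2-simplex are the three edges of a graph triangle:
    \<open>a i\<close> and \<open>b i\<close> meet in \<open>x i\<close>, \<open>a i\<close> and
    \<open>c i\<close> in \<open>y i\<close>, \<open>b i\<close> and \<open>c i\<close> in
    \<open>z i\<close>. Hence each proper face lies in a star.\<close>
  define a b c where "a i = {x i, y i}" and "b i = {x i, z i}" and "c i = {y i, z i}" for i
  have abc: "\<tau> i = {a i, b i, c i}" "{a i, b i, c i} \<subseteq> E"
      "a i \<noteq> b i \<and> a i \<noteq> c i \<and> b i \<noteq> c i" if "i < k" for i
    using xyz[OF that] by (auto simp: a_def b_def c_def doubleton_eq_iff)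
  interpret attached_triangles E K k a b c
  proof
    show "finite E" by (rule finE)
    show "down_closed K" unfolding K_def by (rule down_closed_faces)
    fix i assume i: "i < k"
    show "{a i, b i, c i} \<subseteq> E" "a i \<noteq> b i \<and> a i \<noteq> c i \<and> b i \<noteq> c i" by (rule abc[OF i])+
    show "{a i, b i, c i} \<notin> K" using \<tau>R[OF i] abc(1)[OF i] by (auto simp: R_def)
    show "S \<in> K" if S: "S \<subset> {a i, b i, c i}" for S
    proof -
      have xV: "x i \<in> V" "y i \<in> V" "z i \<in> V"
        using abc(2)[OF i] edge(1) by (auto simp: a_def b_def c_def)
      have "S \<subseteq> {a i, b i} \<or> S \<subseteq> {a i, c i} \<or> S \<subseteq> {b i, c i}"
        using S by blast
      moreover have "{a i, b i} \<subseteq> star E (x i)" "{a i, c i} \<subseteq> star E (y i)" "{b i, c i} \<subseteq> star E (z i)"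
        using abc(2)[OF i] by (auto simp: star_def a_def b_def c_def)
      ultimately obtain v where "v \<in> V" "S \<subseteq> star E v"
        using xV by (meson subset_trans)
      then show ?thesis unfolding K_def by (blast intro: facesI)
    qed
    show "i = j" if "j < k" "{a i, b i, c i} = {a j, b j, c j}" for j
      using \<tau> abc(1)[OF i] abc(1)[OF that(1)] i that unfolding bij_betw_def inj_on_def k_def by simp
  qed
  have tr_R: "tr ` {..<k} = R"
  proof -
    have "tr ` {..<k} = \<tau> ` {..<k}"
      by (rule image_cong) (auto simp: tr_def abc)
    then show ?thesis using \<tau> by (simp add: bij_betw_def k_def)
  qed
  \<comment> \<open>Only the triangles in \<open>R\<close> themselves have to be added, since their
    proper faces are already in \<open>K\<close>.\<close>
  have eq: "line_clique_complex E = K \<union> R"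
  proof -
    have "faces (star E ` V \<union> triangles E) \<subseteq> K \<union> R"
    proof
      fix S assume "S \<in> faces (star E ` V \<union> triangles E)"
      then obtain \<sigma> where \<sigma>: "\<sigma> \<in> star E ` V \<union> triangles E" "S \<subseteq> \<sigma>" by (auto simp: faces_def)
      show "S \<in> K \<union> R"
      proof (cases "\<sigma> \<in> R")
        case True
        then obtain i where i: "i < k" "\<sigma> = tr i" using tr_R by blast
        then show ?thesis
          using boundary[OF i(1), of S] \<sigma>(2) True unfolding tr_def by blast
      next
        case False
        then have "\<sigma> \<in> K"
          using \<sigma>(1) unfolding R_def K_def by (blast intro: facesI)
        then show ?thesis using down_closedD[OF down_K _ \<sigma>(2)] by blast
      qed
    qed
    moreover have "K \<subseteq> faces (star E ` V \<union> triangles E)"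
      unfolding K_def using T by (intro faces_subset) (blast intro: facesI)
    moreover have "R \<subseteq> faces (star E ` V \<union> triangles E)"
      unfolding R_def by (blast intro: facesI)
    ultimately show ?thesis
      unfolding line_clique_complex_eq_faces[OF G \<open>V \<noteq> {}\<close>] by blast
  qed
  have single: "{e} \<in> K" if e: "e \<in> E" for e
  proof -
    obtain v where "v \<in> e" using edge(2)[OF e] by fastforce
    then have "{e} \<subseteq> star E v" "v \<in> V" using edge(1)[OF e] e by (auto simp: star_def)
    then show ?thesis unfolding K_def by (blast intro: facesI)
  qed
  \<comment> \<open>\<open>geometric_realization\<close> takes the vertices of the complex as
    coordinates, so these must be identified with the ambient set \<open>E\<close>.\<close>
  have "\<Union>(K \<union> R) = E"
  proof
    show "\<Union>(K \<union> R) \<subseteq> E"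
    proof (rule Union_least)
      fix S assume "S \<in> K \<union> R"
      then consider \<sigma> where "\<sigma> \<in> star E ` V \<union> T" "S \<subseteq> \<sigma>" | "S \<in> triangles E"
        unfolding K_def R_def faces_def by blast
      then show "S \<subseteq> E"
        by cases (use star_Un_subset_edges[OF T] triE in \<open>blast+\<close>)
    qed
    show "E \<subseteq> \<Union>(K \<union> R)" using single by blast
  qed
  then have "geometric_realization (line_clique_complex E) = X"
    by (simp add: geometric_realization_eq eq tr_R)
  \<comment> \<open>This needs an edge: without edges the complex has no points, whereas even the
    empty wedge contains \<open>None\<close>.\<close>
  moreover have "topspace Y \<noteq> {}"
  proof -
    obtain e where e: "e \<in> E" using assms(4) by blast
    let ?x = "\<lambda>f\<in>E. if f = e then 1 else (0::real)"
    have "(\<Sum>f\<in>E. ?x f) = (\<Sum>f\<in>E. if f = e then 1 else 0)" by (intro sum.cong) auto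
    also have "\<dots> = 1" using e finE by simp
    finally have "(\<Sum>f\<in>E. ?x f) = 1" .
    moreover have "{f \<in> E. ?x f \<noteq> 0} = {e}" using e by auto
    ultimately have "?x \<in> topspace Y" using single[OF e] by (simp add: topspace_realization)
    then show ?thesis by blast
  qed
  moreover have "contractible_space Y" using contr by (simp add: K_def)
  ultimately show ?thesis
    using homotopy_equivalent_wedge by auto
qed

end
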